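(* Let $\mathcal{M}$ be either an orientably-regular map with $G=\mathrm{Aut}^+(\mathcal{M})$ or a regular map with $G=\mathrm{Aut}(\mathcal{M})$. Let $\pi$ be the set of prime divisors of the number of vertices of $\mathcal{M}$. Suppose $G$ is solvable and $G$ has no normal $\pi$-Hall subgroup. Let $O_\pi(G)$ be the largest normal $\pi$-subgroup of $G$, and let $\overline{\mathcal{M}}$ be the quotient map of $\mathcal{M}$ induced by $O_\pi(G)$. Then one of the following holds: (1) $2\in\pi$ and $\overline{\mathcal{M}}=\mathcal{D}(m,e)$, where $m\ge3$ is odd, $e^2\equiv1\pmod m$ and $e\not\equiv1\pmod m$; (2) $2\in\pi$, $\overline{\mathcal{M}}=DM(m)$, and $\mathcal{M}$ is a nonorientable, nonnormal regular map; (3) $2\in\pi$, $\overline{\mathcal{M}}=EM(m)$, and $\mathcal{M}$ is normal as an orientably-regular map but nonnormal as a regular map; (4) $2\notin\pi$, $3\in\pi$, $\overline{\mathcal{M}}=\mathcal{C}(3,2)$, and $\mathcal{M}$ is a nonorientable, nonnormal regular map.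
   Context: Orientably-regular maps are $\mathcal{M}(G;r,\ell)$ with $G=\langle r,\ell\rangle$ finite and $\ell$ an involution. Here $G\cong\mathrm{Aut}^+(\mathcal{M})$ acts regularly on darts, and the vertices are the cosets of $\langle r\rangle$. Regular maps are $\mathcal{M}(G;t,r,\ell)$ with $G=\langle t,r,\ell\rangle$ finite, $t,r,\ell$ involutions and $t\ell=\ell t$. Here $G\cong\mathrm{Aut}(\mathcal{M})$ acts regularly on flags, and the vertices are the cosets of $\langle t,r\rangle$. Such a map is orientable iff $\langle tr,r\ell\rangle$ has index $2$ in $G$, in which case $\mathrm{Aut}^+(\mathcal{M})=\langle tr,r\ell\rangle$. For $N\trianglelefteq G$, the quotient map induced by $N$ is the (possibly degenerate) map with the images of the generators in $G/N$. A map is called normal (as an orientably-regular, respectively regular, map) if $\mathrm{Aut}^+(\mathcal{M})$, respectively $\mathrm{Aut}(\mathcal{M})$, has a normal $\pi$-Hall subgroup, where $\pi$ is the set of primes dividing the number of vertices. $\mathcal{D}(m,e)$ is the orientably-regular map of the dipole $\mathcal{D}_m$ (two vertices joined by $m$ parallel edges) with group $\langle x,y\mid x^m=y^2=1,\ y^{-1}xy=x^e\rangle$, rotation $x$ and an involution $\ell\notin\langle x\rangle$. $DM(m)$ and $EM(m)$ are the regular maps of the $m$-semistar $\mathcal{S}_m$ (one vertex with $m$ semi-edges) in a disc, respectively in a sphere. Algebraically, the group is the dihedral group $\langle r,t\rangle$ of order $2m$, with $\ell=1$ for $DM(m)$ and $\ell=t$ for $EM(m)$. In this one case the disc is admitted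 as a surface with boundary. $\mathcal{C}(3,2)$ is the unique nonorientable regular map of $C_3^{(2)}$, the $3$-cycle with each edge doubled. Its automorphism group is $S_4$, with vertex stabiliser dihedral of order $8$.
   Formalization: For a regular map M, case (1) is read as: M is orientable and the images of its orientably-regular generators tr, tl in G/O_π(G) give D(m,e). The literal claim fails for the spherical dipole (m odd), where the quotient of the regular map is DM(m) though M is orientable. *)

theory Defs
  imports "HOL-Algebra.Solvable_Groups" "HOL-Number_Theory.Cong"
begin

section \<open>Hall subgroups and the largest normal pi-subgroup\<close>

definition pi_number :: "nat set \<Rightarrow> nat \<Rightarrow> bool" where
  "pi_number \<pi> n \<longleftrightarrow> prime_factors n \<subseteq> \<pi>"

definition hall_subgroup :: "nat set \<Rightarrow> 'a set \<Rightarrow> 'a monoid \<Rightarrow> bool" where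
  "hall_subgroup \<pi> H G \<longleftrightarrow>
     subgroup H G \<and> pi_number \<pi> (card H) \<and> prime_factors (card (rcosets\<^bsub>G\<^esub> H)) \<inter> \<pi> = {}"

definition has_normal_hall :: "nat set \<Rightarrow> 'a monoid \<Rightarrow> bool" where
  "has_normal_hall \<pi> G \<longleftrightarrow> (\<exists>H. H \<lhd> G \<and> hall_subgroup \<pi> H G)"

definition O_pi :: "nat set \<Rightarrow> 'a monoid \<Rightarrow> 'a set" where
  "O_pi \<pi> G = (GREATEST N. N \<lhd> G \<and> pi_number \<pi> (card N))"


section \<open>Maps given by generators of their automorphism groups\<close>

text \<open>
  \<open>ORMap G r l\<close> stands for the orientably-regular map \<open>M(G; r, l)\<close>, and
  \<open>RegMap G t r l\<close> for the regular map \<open>M(G; t, r, l)\<close>. The type also contains the degenerate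
  quotients, in which generators may collapse; \<open>is_map\<close> singles out the proper maps.
\<close>

datatype 'a algebraic_map =
    ORMap "'a monoid" 'a 'a
  | RegMap "'a monoid" 'a 'a 'a

definition involution :: "'a monoid \<Rightarrow> 'a \<Rightarrow> bool" where
  "involution G x \<longleftrightarrow> x \<in> carrier G \<and> x \<noteq> \<one>\<^bsub>G\<^esub> \<and> x \<otimes>\<^bsub>G\<^esub> x = \<one>\<^bsub>G\<^esub>"

fun is_map :: "'a algebraic_map \<Rightarrow> bool" where
  "is_map (ORMap G r l) \<longleftrightarrow>
     group G \<and> finite (carrier G) \<and> r \<in> carrier G \<and> involution G l \<and>
     generate G {r, l} = carrier G"
| "is_map (RegMap G t r l) \<longleftrightarrow>
     group G \<and> finite (carrier G) \<and> involution G t \<and> involution G r \<and> involution G l \<and>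
     t \<otimes>\<^bsub>G\<^esub> l = l \<otimes>\<^bsub>G\<^esub> t \<and> generate G {t, r, l} = carrier G"

text \<open>\<open>Aut\<^sup>+\<close> of an orientably-regular map, \<open>Aut\<close> of a regular map.\<close>

fun aut_group :: "'a algebraic_map \<Rightarrow> 'a monoid" where
  "aut_group (ORMap G r l) = G"
| "aut_group (RegMap G t r l) = G"

fun vertices :: "'a algebraic_map \<Rightarrow> 'a set set" where
  "vertices (ORMap G r l) = rcosets\<^bsub>G\<^esub> (generate G {r})"
| "vertices (RegMap G t r l) = rcosets\<^bsub>G\<^esub> (generate G {t, r})"

fun edges :: "'a algebraic_map \<Rightarrow> 'a set set" where
  "edges (ORMap G r l) = rcosets\<^bsub>G\<^esub> (generate G {l})"
| "edges (RegMap G t r l) = rcosets\<^bsub>G\<^esub> (generate G {t, l})"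

definition vertex_primes :: "'a algebraic_map \<Rightarrow> nat set" where
  "vertex_primes M = prime_factors (card (vertices M))"

fun map_quotient :: "'a algebraic_map \<Rightarrow> 'a set \<Rightarrow> 'a set algebraic_map" where
  "map_quotient (ORMap G r l) N = ORMap (G Mod N) (N #>\<^bsub>G\<^esub> r) (N #>\<^bsub>G\<^esub> l)"
| "map_quotient (RegMap G t r l) N =
     RegMap (G Mod N) (N #>\<^bsub>G\<^esub> t) (N #>\<^bsub>G\<^esub> r) (N #>\<^bsub>G\<^esub> l)"

fun map_iso :: "'a algebraic_map \<Rightarrow> 'b algebraic_map \<Rightarrow> bool" where
  "map_iso (ORMap G r l) (ORMap G' r' l') \<longleftrightarrow> (\<exists>h \<in> iso G G'. h r = r' \<and> h l = l')"
| "map_iso (RegMap G t r l) (RegMap G' t' r' l') \<longleftrightarrow>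
     (\<exists>h \<in> iso G G'. h t = t' \<and> h r = r' \<and> h l = l')"
| "map_iso (ORMap _ _ _) (RegMap _ _ _ _) \<longleftrightarrow> False"
| "map_iso (RegMap _ _ _ _) (ORMap _ _ _) \<longleftrightarrow> False"


section \<open>Orientability and normality\<close>

fun even_subgroup :: "'a algebraic_map \<Rightarrow> 'a set" where
  "even_subgroup (ORMap G r l) = carrier G"
| "even_subgroup (RegMap G t r l) = generate G {t \<otimes>\<^bsub>G\<^esub> r, r \<otimes>\<^bsub>G\<^esub> l}"

fun orientable :: "'a algebraic_map \<Rightarrow> bool" where
  "orientable (ORMap G r l) \<longleftrightarrow> True"
| "orientable (RegMap G t r l) \<longleftrightarrow>
     card (rcosets\<^bsub>G\<^esub> (even_subgroup (RegMap G t r l))) = 2"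

fun is_regular :: "'a algebraic_map \<Rightarrow> bool" where
  "is_regular (ORMap G r l) \<longleftrightarrow> False"
| "is_regular (RegMap G t r l) \<longleftrightarrow> True"

text \<open>
  The rotation about a vertex is \<open>t r\<close>, the half-turn of an edge is \<open>t l\<close>; together they
  generate the even subgroup, since \<open>t l = (t r)(r l)\<close>. For an orientable regular map,
  \<open>rotary_map\<close> is the same map regarded as an orientably-regular map. If \<open>M\<close> is an
  orientable regular map and \<open>N\<close> is normal in \<open>Aut M\<close>, then \<open>rotary_map\<close> of the quotient
  of \<open>M\<close> by \<open>N\<close> is given by the images in \<open>Aut M / N\<close> of the rotary generators of \<open>M\<close>,
  i.e. it is the quotient of \<open>M\<close> as an orientably-regular map. This holds also when \<open>N\<close>
  contains orientation-reversing elements.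
\<close>

fun rotary_map :: "'a algebraic_map \<Rightarrow> 'a algebraic_map" where
  "rotary_map (ORMap G r l) = ORMap G r l"
| "rotary_map (RegMap G t r l) =
     ORMap (G\<lparr>carrier := even_subgroup (RegMap G t r l)\<rparr>) (t \<otimes>\<^bsub>G\<^esub> r) (t \<otimes>\<^bsub>G\<^esub> l)"

definition normal_as_orientably_regular :: "'a algebraic_map \<Rightarrow> bool" where
  "normal_as_orientably_regular M \<longleftrightarrow>
     orientable M \<and> has_normal_hall (vertex_primes M) (aut_group (rotary_map M))"

definition normal_as_regular :: "'a algebraic_map \<Rightarrow> bool" where
  "normal_as_regular M \<longleftrightarrow> is_regular M \<and> has_normal_hall (vertex_primes M) (aut_group M)"

definition nonnormal_regular :: "'a algebraic_map \<Rightarrow> bool" where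
  "nonnormal_regular M \<longleftrightarrow> is_regular M \<and> \<not> normal_as_regular M"


section \<open>The exceptional quotients\<close>

text \<open>
  The group \<open>\<langle>x, y | x^m = y^2 = 1, y^-1 x y = x^e\<rangle>\<close> for \<open>e^2 = 1\<close> modulo \<open>m\<close>, of order \<open>2m\<close>.
  The pair \<open>(i, b)\<close> stands for \<open>x^i y^b\<close>; thus \<open>y x^j = x^(e j) y\<close>.
\<close>

definition dipole_group :: "nat \<Rightarrow> int \<Rightarrow> (int \<times> bool) monoid" where
  "dipole_group m e =
     \<lparr> carrier = {0..<int m} \<times> UNIV,
       monoid.mult = (\<lambda>(i, b) (j, c). ((i + (if b then e * j else j)) mod int m, b \<noteq> c)),
       one = (0, False) \<rparr>"

definition dipole_x :: "nat \<Rightarrow> int \<times> bool" where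
  "dipole_x m = (1 mod int m, False)"

definition dipole_y :: "int \<times> bool" where
  "dipole_y = (0, True)"

lemma group_dipole_group:
  assumes "m > 0" "[e ^ 2 = 1] (mod int m)"
  shows "group (dipole_group m e)"
proof -
  have e2: "e * e * k mod int m = k mod int m" for k
    using cong_mult[OF assms(2) cong_refl[of k]]
    by (simp add: cong_def power2_eq_square mult.assoc)
  have inv: "(- (e * i) mod int m + e * i) mod int m = 0" for i
    by (simp add: mod_simps)
  have eejk: "(i + (e * j + e * (e * k))) mod int m = (i + (e * j + k)) mod int m" for i j k
    using e2[of k] by (metis mod_add_right_eq mult.assoc)
  have em: "(a + e * (b mod int m)) mod int m = (a + e * b) mod int m" for a b
    by (rule mod_add_cong[OF refl mod_mult_right_eq])
  show ?thesis
  proof (rule groupI, goal_cases)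
    case (3 x y z)
    obtain i b j c k d where "x = (i, b)" "y = (j, c)" "z = (k, d)"
      by (cases x; cases y; cases z)
    then show ?case
      by (cases b; cases c)
         (simp_all add: dipole_group_def em mod_add_left_eq mod_add_right_eq distrib_left
            add.assoc eejk)
  next
    case (5 x)
    obtain i b where x: "x = (i, b)" by (cases x)
    show ?case
    proof (cases b)
      case True
      then show ?thesis
        using inv[of i] assms(1) x
        by (intro bexI[of _ "(- (e * i) mod int m, True)"]) (auto simp: dipole_group_def)
    next
      case False
      then show ?thesis
        using assms(1) x
        by (intro bexI[of _ "((- i) mod int m, False)"]) (auto simp: dipole_group_def mod_simps)
    qed
  qed (use assms(1) in \<open>auto simp: dipole_group_def\<close>)
qed

definition is_D :: "'a algebraic_map \<Rightarrow> nat \<Rightarrow> int \<Rightarrow> bool" where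
  "is_D M m e \<longleftrightarrow>
     (\<exists>l. involution (dipole_group m e) l \<and> l \<notin> generate (dipole_group m e) {dipole_x m} \<and>
          map_iso M (ORMap (dipole_group m e) (dipole_x m) l))"

text \<open>
  With \<open>e = -1\<close> the group is dihedral of order \<open>2m\<close>, generated by the involutions \<open>y\<close> and
  \<open>x y\<close>, whose product generates the rotations.
\<close>

definition dihedral_r :: "nat \<Rightarrow> int \<times> bool" where
  "dihedral_r m = (1 mod int m, True)"

definition dihedral_t :: "int \<times> bool" where
  "dihedral_t = dipole_y"

definition DM :: "nat \<Rightarrow> (int \<times> bool) algebraic_map" where
  "DM m = RegMap (dipole_group m (- 1)) dihedral_t (dihedral_r m) \<one>\<^bsub>dipole_group m (- 1)\<^esub>"

definition EM :: "nat \<Rightarrow> (int \<times> bool) algebraic_map" where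
  "EM m = RegMap (dipole_group m (- 1)) dihedral_t (dihedral_r m) dihedral_t"

text \<open>
  Isomorphism of the underlying graph with the 3-cycle with doubled edges, whose vertices are
  0, 1, 2 and whose edges \<open>(i, b)\<close> join \<open>i\<close> to \<open>i + 1\<close> modulo 3. A vertex and an edge are
  incident when the two cosets meet.
\<close>

definition underlies_doubled_3_cycle :: "'a algebraic_map \<Rightarrow> bool" where
  "underlies_doubled_3_cycle M \<longleftrightarrow>
     (\<exists>f g. bij_betw f (vertices M) {0..<3 :: nat} \<and>
            bij_betw g (edges M) ({0..<3 :: nat} \<times> (UNIV :: bool set)) \<and>
            (\<forall>v \<in> vertices M. \<forall>d \<in> edges M.
               v \<inter> d \<noteq> {} \<longleftrightarrow> f v \<in> {fst (g d), (fst (g d) + 1) mod 3}))"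

text \<open>
  Up to isomorphism there is exactly one such map: its group is \<open>S\<^sub>4\<close>, with
  \<open>t = (1 2)(3 4)\<close>, \<open>r = (1 3)\<close>, \<open>l = (1 2)\<close>.
\<close>

definition is_C32 :: "'a algebraic_map \<Rightarrow> bool" where
  "is_C32 M \<longleftrightarrow>
     is_regular M \<and> is_map M \<and> \<not> orientable M \<and> underlies_doubled_3_cycle M"

end

theory Submission
  imports Defs "HOL-Algebra.Multiplicative_Group" "HOL-Algebra.Sylow" "HOL-Algebra.SndIsomorphismGrp"
begin

text \<open>
  Pass to \<open>Q = G / O\<^sub>\<pi>(G)\<close>, which has no nontrivial normal \<open>\<pi>\<close>-subgroup, and let \<open>K\<close> be its largest
  normal \<open>\<pi>'\<close>-subgroup. As \<open>Q\<close> is solvable, \<open>K\<close> contains its own centralizer; as the vertex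
  stabilizer \<open>H\<close> has \<open>\<pi>\<close>-index, \<open>K \<subseteq> H\<close>. If \<open>H = \<langle>r\<rangle>\<close> is cyclic, it centralizes \<open>K\<close>, so \<open>K = H\<close>,
  and \<open>Q = K \<langle>l\<rangle>\<close> with \<open>l\<close> acting nontrivially. If \<open>H = \<langle>t, r\<rangle>\<close> and \<open>2 \<in> \<pi>\<close>, then \<open>K\<close> has odd order,
  so \<open>K = \<langle>t r\<rangle>\<close> and \<open>Q = K \<langle>t, l\<rangle>\<close>; the cases \<open>l = t\<close>, \<open>l = 1\<close> and the remaining one are told apart
  by orientability.

  If \<open>2 \<notin> \<pi>\<close>, take an element \<open>g\<close> of odd prime order in \<open>\<pi>\<close>. Were \<open>K \<inter> \<langle>t r\<rangle>\<close> normal, \<open>g\<close> would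
  centralize it, because involutions generate a group of exponent two of automorphisms of a cyclic
  group, and hence \<open>g\<close> would centralize \<open>K\<close>. So \<open>K \<inter> \<langle>t r\<rangle>\<close> is not characteristic in \<open>K\<close>, which
  forces \<open>K\<close> to be a four-group and \<open>Q / K\<close> to be the symmetric group on its involutions.
\<close>


text \<open>If \<open>Q\<close> were a \<pi>'-group, \<open>O_pi \<pi> G\<close> would be a normal
  Hall subgroup. So some prime of \<pi> divides the order of \<open>Q\<close>, and this keeps
  \<open>K\<close> proper.

  The obstacle for regular maps is that orientability need not survive the quotient: for 2 \<in>
  \<pi> the kernel may contain orientation-reversing elements. If the image of \<open>l\<close> is
  nontrivial, the image of \<open>t\<close> stays outside the even part of \<open>Q\<close>, so M is
  orientable. Hence only a trivial image of \<open>l\<close> leaves both possibilities open: an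
  orientable M gives (1), with a dihedral group, and a nonorientable M gives (2). If the images of
  \<open>l\<close> and \<open>t\<close> agree, the even part of \<open>Q\<close> is
  \<open>K\<close>, which is why the kernel is a Hall subgroup of the even part of G in (3). For 2
  \<notin> \<pi> the kernel has odd order, so it lies in the even part and nonorientability lifts.

  In (4) the index of \<open>K\<close> is at most 6 and divisible by 2 and by an odd prime of \<pi>;
  so this prime is 3 and \<open>Q\<close> has order 4 * 6 = 24. The map is then recognized by
  counting incidences, without an explicit isomorphism with a symmetric group.\<close>

section \<open>Numbers composed of given primes\<close>

lemma pi_number_1 [simp]: "pi_number \<pi> (Suc 0)"
  by (simp add: pi_number_def)

lemma pi_number_mult:
  assumes "pi_number \<pi> m" "pi_number \<pi> n"
  shows "pi_number \<pi> (m * n)"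
proof (cases "m = 0 \<or> n = 0")
  case False
  then show ?thesis
    using assms by (simp add: pi_number_def prime_factors_product)
qed (auto simp: pi_number_def)

lemma pi_number_dvd:
  assumes "pi_number \<pi> n" "m dvd n" "n > 0"
  shows "pi_number \<pi> m"
  using assms dvd_prime_factors[of n m] by (auto simp: pi_number_def)

lemma pi_number_Compl_iff: "pi_number (- \<pi>) n \<longleftrightarrow> prime_factors n \<inter> \<pi> = {}"
  by (auto simp: pi_number_def)

lemma pi_number_coprime:
  assumes "pi_number \<pi> m" "pi_number (- \<pi>) n" "m > 0" "n > 0"
  shows "coprime m n"
proof (rule ccontr)
  assume "\<not> coprime m n"
  then obtain p where "prime p" "p dvd m" "p dvd n"
    using assms(3) by (metis coprime_iff_gcd_eq_1 gcd_nat.boundedE prime_factor_nat)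
  then have "p \<in> prime_factors m" "p \<in> prime_factors n"
    using assms by (auto simp: in_prime_factors_iff)
  then show False
    using assms by (auto simp: pi_number_def)
qed


section \<open>Orders of subgroups and of their images\<close>

text \<open>The first isomorphism theorem for the restriction of \<open>h\<close> to
  \<open>S\<close>. Orders in quotients are compared through this formula.\<close>

lemma (in group_hom) card_subgroup_image:
  assumes S: "subgroup S G"
  shows "card S = card (h ` S) * card (kernel G H h \<inter> S)"
proof -
  let ?S = "G\<lparr>carrier := S\<rparr>" and ?I = "H\<lparr>carrier := h ` S\<rparr>"
  interpret S: group ?S
    using S by (rule G.subgroup_imp_group)
  have "group ?I"
    using S subgroup_img_is_subgroup H.subgroup_imp_group by blast
  moreover have "h \<in> hom ?S ?I"
    using subgroup.mem_carrier[OF S] by (auto simp: hom_def)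
  ultimately interpret SI: group_hom ?S ?I h
    by (simp add: group_hom_def group_hom_axioms_def S.is_group)
  have k: "kernel ?S ?I h = kernel G H h \<inter> S"
    using subgroup.subset[OF S] by (auto simp: kernel_def)
  have "(\<lambda>X. the_elem (h ` X)) \<in> iso (?S Mod (kernel ?S ?I h)) ?I"
    by (rule SI.FactGroup_iso_set) simp
  then have "card (carrier (?S Mod (kernel ?S ?I h))) = card (h ` S)"
    using iso_same_card[OF is_isoI] by fastforce
  then have "card (rcosets\<^bsub>?S\<^esub> (kernel ?S ?I h)) = card (h ` S)"
    by (simp add: FactGroup_def)
  then show ?thesis
    using S.lagrange[OF SI.subgroup_kernel] k by (simp add: order_def)
qed

lemma (in normal) group_hom_Mod: "group_hom G (G Mod H) (\<lambda>a. H #> a)"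
  using r_coset_hom_Mod factorgroup_is_group
  by (simp add: group_hom_def group_hom_axioms_def is_group)

lemma (in normal) rcoset_eq_iff: "a \<in> carrier G \<Longrightarrow> H #> a = H \<longleftrightarrow> a \<in> H"
  by (rule iffI, erule coset_join1[OF _ _ subgroup_axioms], assumption,
      rule coset_join2[OF _ subgroup_axioms])

lemma (in normal) kernel_Mod: "kernel G (G Mod H) (\<lambda>a. H #> a) = H"
proof -
  have "kernel G (G Mod H) (\<lambda>a. H #> a) = {a \<in> carrier G. a \<in> H}"
    unfolding kernel_def one_FactGroup using rcoset_eq_iff by blast
  then show ?thesis using subset by blast
qed

text \<open>\<open>K <#> H\<close> and \<open>H\<close> have the same image modulo \<open>K\<close>,
  while they meet the kernel in \<open>K\<close> and in \<open>K \<inter> H\<close>.\<close>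

lemma (in group) card_set_mult:
  assumes K: "K \<lhd> G" and H: "subgroup H G"
  shows "card (K <#> H) * card (K \<inter> H) = card K * card H"
proof -
  interpret K: normal K G by (rule K)
  interpret h: group_hom G "G Mod K" "\<lambda>a. K #> a" by (rule K.group_hom_Mod)
  interpret s: second_isomorphism_grp K G H
    using H K by (simp add: second_isomorphism_grp_def second_isomorphism_grp_axioms_def)
  have "(\<lambda>a. K #> a) ` (K <#> H) = (\<lambda>a. K #> a) ` H"
  proof -
    have *: "K #> (k \<otimes> x) = K #> x" if "k \<in> K" "x \<in> H" for k x
    proof -
      have "K #> (k \<otimes> x) = (K #> k) #> x"
        using that subgroup.mem_carrier[OF H] K.subset by (simp add: coset_mult_assoc)
      then show ?thesis using that K.rcos_const[OF is_group] by simp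
    qed
    show ?thesis
    proof
      show "(\<lambda>a. K #> a) ` (K <#> H) \<subseteq> (\<lambda>a. K #> a) ` H"
        using * by (auto simp: set_mult_def)
      show "(\<lambda>a. K #> a) ` H \<subseteq> (\<lambda>a. K #> a) ` (K <#> H)"
        using s.S_contained_in_set_mult by (rule image_mono)
    qed
  qed
  moreover have "K \<inter> (K <#> H) = K"
    using s.H_contained_in_set_mult by blast
  ultimately show ?thesis
    using h.card_subgroup_image[OF s.normal_set_mult_subgroup]
      h.card_subgroup_image[OF H] by (simp add: K.kernel_Mod)
qed

lemma (in group) card_subgroup_dvd:
  assumes "finite (carrier G)" "subgroup H G"
  shows "card H dvd order G"
  using lagrange_finite[OF assms] by (metis dvd_triv_right)

lemma (in group) card_subgroup_dvd_subgroup: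
  assumes fin: "finite (carrier G)" and A: "subgroup A G" and B: "subgroup B G" "A \<subseteq> B"
  shows "card A dvd card B"
  using group.card_subgroup_dvd[OF subgroup_imp_group[OF B(1)] _ subgroup_incl[OF A B]]
    fin subgroup.subset[OF B(1)] by (simp add: order_def finite_subset)

lemma (in group) card_subgroup_pos:
  assumes "finite (carrier G)" "subgroup H G"
  shows "card H > 0"
  using assms subgroup.finite_imp_card_positive by blast

lemma (in group) ord_subgroup_dvd:
  assumes "finite (carrier G)" "subgroup H G" "x \<in> H"
  shows "ord x dvd card H"
proof -
  interpret H: group "G\<lparr>carrier := H\<rparr>" using assms subgroup_imp_group by blast
  have "x [^] card H = \<one>"
    using H.pow_order_eq_1[of x] assms by (simp add: order_def nat_pow_consistent[symmetric])
  then show ?thesis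
    using pow_eq_id[of x] subgroup.mem_carrier[OF assms(2,3)] by simp
qed

lemma (in group) cauchy:
  assumes fin: "finite (carrier G)" and H: "subgroup H G" and p: "prime p" "p dvd card H"
  obtains x where "x \<in> H" "ord x = p"
proof -
  interpret H: group "G\<lparr>carrier := H\<rparr>" using H subgroup_imp_group by blast
  have "finite H" using fin H subgroup.subset finite_subset by blast
  \<comment> \<open>Sylow's theorem with exponent 1, where the cofactor may still be divisible by p;
    every nontrivial element of \<open>P\<close> then has order p.\<close>
  then obtain P where P: "subgroup P (G\<lparr>carrier := H\<rparr>)" "card P = p"
    using sylow_thm[of p "G\<lparr>carrier := H\<rparr>" 1 "card H div p"] p H.is_group
    by (auto simp: order_def)
  then have PG: "subgroup P G" "P \<subseteq> H"
    using incl_subgroup[OF H P(1)] subgroup.subset[OF P(1)] by simp_all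
  obtain x where x: "x \<in> P" "x \<noteq> \<one>"
  proof -
    have "P \<noteq> {\<one>}" using P(2) p(1) by (auto dest: prime_gt_1_nat)
    moreover have "\<one> \<in> P" using PG(1) by (rule subgroup.one_closed)
    ultimately show ?thesis using that by blast
  qed
  have "ord x dvd p" using ord_subgroup_dvd[OF fin PG(1) x(1)] P by simp
  moreover have "ord x \<noteq> 1" using x ord_eq_1 subgroup.mem_carrier[OF PG(1) x(1)] by simp
  ultimately have "ord x = p" using p(1) by (metis prime_nat_iff)
  then show ?thesis using that x PG by blast
qed

text \<open>By Cauchy, a prime divisor of the order of \<open>H\<close> is the order of some x in
  \<open>H\<close>, so it divides the \<pi>-number that annihilates x.\<close>

lemma (in group) pi_number_card_subgroupI:
  assumes fin: "finite (carrier G)" and H: "subgroup H G"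
    and *: "\<And>x. x \<in> H \<Longrightarrow> \<exists>n>0. pi_number \<pi> n \<and> x [^] (n::nat) = \<one>"
  shows "pi_number \<pi> (card H)"
  unfolding pi_number_def
proof
  fix p assume "p \<in> prime_factors (card H)"
  then have p: "prime p" "p dvd card H" by (auto simp: in_prime_factors_iff)
  then obtain x where x: "x \<in> H" "ord x = p" using cauchy[OF fin H] by blast
  then obtain n :: nat where n: "n > 0" "pi_number \<pi> n" "x [^] n = \<one>" using * by blast
  then have "p dvd n" using x pow_eq_id[of x n] subgroup.mem_carrier[OF H x(1)] by simp
  then have "p \<in> prime_factors n" using p n by (simp add: in_prime_factors_iff)
  then show "p \<in> \<pi>" using n by (auto simp: pi_number_def)
qed


section \<open>The largest normal subgroup composed of given primes\<close>

locale finite_group = group G for G :: "'a monoid" (structure) +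
  assumes fin: "finite (carrier G)"

text \<open>A maximal normal \<pi>-subgroup \<open>N\<close> absorbs every other one,
  \<open>M\<close>: the product \<open>N <#> M\<close> is normal, and its order divides the product
  of the two orders. So the \<open>GREATEST\<close> in the definition exists with respect to
  inclusion.\<close>

lemma (in finite_group)
  shows O_pi_normal: "O_pi \<pi> G \<lhd> G"
    and O_pi_pi_number: "pi_number \<pi> (card (O_pi \<pi> G))"
    and O_pi_greatest: "\<And>N. N \<lhd> G \<Longrightarrow> pi_number \<pi> (card N) \<Longrightarrow> N \<subseteq> O_pi \<pi> G"
proof -
  let ?P = "\<lambda>N. N \<lhd> G \<and> pi_number \<pi> (card N)"
  have "{N. ?P N} \<subseteq> Pow (carrier G)"
    using normal_imp_subgroup[THEN subgroup.subset] by auto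
  then have f: "finite {N. ?P N}" using fin by (meson finite_Pow_iff finite_subset)
  have "?P {\<one>}" using one_is_normal by simp
  with f obtain N where N: "?P N" and max: "\<And>M. ?P M \<Longrightarrow> N \<subseteq> M \<Longrightarrow> M = N"
    using finite_has_maximal[of "{N. ?P N}"] by (metis (no_types, lifting) empty_iff mem_Collect_eq)
  have le: "M \<subseteq> N" if "?P M" for M
  proof -
    interpret s: second_isomorphism_grp N G M
      using N that normal_imp_subgroup unfolding second_isomorphism_grp_def second_isomorphism_grp_axioms_def by blast
    have NM: "subgroup (N <#> M) G" by (rule s.normal_set_mult_subgroup)
    have "card (N <#> M) dvd card N * card M"
      using card_set_mult[of N M] N that normal_imp_subgroup by (metis dvd_triv_left)
    then have "pi_number \<pi> (card (N <#> M))"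
      using N that card_subgroup_pos[OF fin] normal_imp_subgroup
      by (metis pi_number_dvd pi_number_mult nat_0_less_mult_iff)
    then have "?P (N <#> M)"
      using normal_subgroup_set_mult_closed N that by blast
    then have "N <#> M = N"
      using max s.H_contained_in_set_mult by blast
    then show ?thesis using s.S_contained_in_set_mult by blast
  qed
  then have "O_pi \<pi> G = N"
    unfolding O_pi_def using N by (intro Greatest_equality) auto
  then show "O_pi \<pi> G \<lhd> G" "pi_number \<pi> (card (O_pi \<pi> G))"
     "\<And>N. N \<lhd> G \<Longrightarrow> pi_number \<pi> (card N) \<Longrightarrow> N \<subseteq> O_pi \<pi> G"
    using N le by auto
qed

text \<open>The preimage \<open>P\<close> of \<open>L\<close> is normal, and its order is that of
  \<open>L\<close> times that of the kernel, again a \<pi>-number. So \<open>P\<close> already lies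
  in the kernel.\<close>

lemma (in finite_group) O_pi_Mod_O_pi:
  assumes L: "L \<lhd> G Mod O_pi \<pi> G" "pi_number \<pi> (card L)"
  shows "L = {\<one>\<^bsub>G Mod O_pi \<pi> G\<^esub>}"
proof -
  let ?N = "O_pi \<pi> G" and ?h = "\<lambda>a. O_pi \<pi> G #> a"
  interpret N: normal ?N G by (rule O_pi_normal)
  interpret h: group_hom G "G Mod ?N" ?h by (rule N.group_hom_Mod)
  interpret L: normal L "G Mod ?N" by (rule L)
  define P where "P = {a \<in> carrier G. ?h a \<in> L}"
  have imgP: "?h ` P = L"
    using L.subset by (auto simp: P_def carrier_FactGroup)
  have sub: "subgroup P G"
  proof (rule subgroupI)
    have "\<one> \<in> P" using L.one_closed h.hom_one by (simp add: P_def)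
    then show "P \<noteq> {}" by blast
  qed (use L.m_inv_closed L.m_closed in \<open>auto simp: P_def simp del: mult_FactGroup\<close>)
  have P: "P \<lhd> G"
  proof (rule normal_invI[OF sub])
    fix x a assume "x \<in> carrier G" "a \<in> P"
    then show "x \<otimes> a \<otimes> inv x \<in> P"
      using L.inv_op_closed2[of "?h x" "?h a"] by (auto simp: P_def)
  qed
  have "kernel G (G Mod ?N) ?h \<inter> P = ?N"
  proof -
    have "?h x \<in> L" if "x \<in> ?N" for x
      using that N.subset N.rcoset_eq_iff[of x] L.one_closed by (simp add: subsetD)
    then show ?thesis
      using N.subset by (auto simp: N.kernel_Mod P_def)
  qed
  then have "card P = card L * card ?N"
    using h.card_subgroup_image[OF sub] imgP by simp
  then have "pi_number \<pi> (card P)"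
    using L O_pi_pi_number by (simp add: pi_number_mult)
  then have "P \<subseteq> ?N" using O_pi_greatest[OF P] by blast
  then have "?h a = ?N" if "a \<in> P" for a
    using that N.subset N.rcoset_eq_iff[of a] by auto
  then have "L \<subseteq> {?N}" using imgP by auto
  then show ?thesis using L.one_closed by auto
qed

text \<open>The index c of \<open>H\<close> in \<open>K <#> H\<close> divides the index of
  \<open>H\<close> in the group, a \<pi>-number. It is also the index of \<open>K \<inter> H\<close>
  in \<open>K\<close>, a \<pi>'-number. Hence c = 1.\<close>

lemma (in group) normal_subset_of_pi_index:
  assumes fin: "finite (carrier G)" and K: "K \<lhd> G" "pi_number (- \<pi>) (card K)"
    and H: "subgroup H G" "pi_number \<pi> (card (rcosets H))"
  shows "K \<subseteq> H"
proof -
  interpret s: second_isomorphism_grp K G H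
    using K H by (simp add: second_isomorphism_grp_def second_isomorphism_grp_axioms_def)
  have KH: "subgroup (K <#> H) G" by (rule s.normal_set_mult_subgroup)
  note pos = card_subgroup_pos[OF fin]
  have HKH: "H \<subseteq> K <#> H" by (rule s.S_contained_in_set_mult)
  have "card H dvd card (K <#> H)" by (rule card_subgroup_dvd_subgroup[OF fin H(1) KH HKH])
  then obtain c where c: "card (K <#> H) = card H * c" ..
  have cK: "c * card (K \<inter> H) = card K"
    using card_set_mult[OF K(1) H(1)] c pos[OF H(1)] by (simp add: mult_ac)
  obtain d where "order G = card (K <#> H) * d"
    using card_subgroup_dvd[OF fin KH] by (auto elim: dvdE)
  then have "card (rcosets H) = c * d"
    using lagrange_finite[OF fin H(1)] c pos[OF H(1)] by (simp add: mult_ac)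
  moreover have "card (rcosets H) > 0"
    using lagrange_finite[OF fin H(1)] fin order_gt_0_iff_finite by (metis nat_0_less_mult_iff)
  ultimately have "pi_number \<pi> c"
    using H(2) pi_number_dvd by (metis dvd_triv_left)
  moreover have "pi_number (- \<pi>) c"
    using cK K pi_number_dvd pos normal_imp_subgroup by (metis dvd_triv_left)
  moreover have "c > 0" using cK pos[OF normal_imp_subgroup[OF K(1)]] by (metis mult_0 gr0I)
  ultimately have "coprime c c" using pi_number_coprime by blast
  then have "card (K \<inter> H) = card K" using cK by simp
  then have "K \<inter> H = K"
    using fin K(1) by (metis card_subset_eq finite_subset inf_le1 normal_imp_subgroup subgroup.subset)
  then show ?thesis by blast
qed


section \<open>Self-centralizing normal subgroups\<close>

definition centralizer :: "'a monoid \<Rightarrow> 'a set \<Rightarrow> 'a set" where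
  "centralizer G K = {c \<in> carrier G. \<forall>k\<in>K. c \<otimes>\<^bsub>G\<^esub> k = k \<otimes>\<^bsub>G\<^esub> c}"

lemma (in group) inv_mult_cancel [simp]:
  assumes "x \<in> carrier G" "y \<in> carrier G"
  shows "inv x \<otimes> (x \<otimes> y) = y" "x \<otimes> (inv x \<otimes> y) = y"
  using assms by (simp_all flip: m_assoc)

lemma (in group) conj_nat_pow:
  assumes "g \<in> carrier G" "x \<in> carrier G"
  shows "(g \<otimes> x \<otimes> inv g) [^] (n::nat) = g \<otimes> x [^] n \<otimes> inv g"
  using assms by (induction n) (simp_all add: m_assoc)

lemma (in group) conj_mult:
  assumes "g \<in> carrier G" "x \<in> carrier G" "y \<in> carrier G"
  shows "g \<otimes> (x \<otimes> y) \<otimes> inv g = (g \<otimes> x \<otimes> inv g) \<otimes> (g \<otimes> y \<otimes> inv g)"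
  using assms by (simp add: m_assoc)

lemma (in group) commute_iff_conj:
  assumes "g \<in> carrier G" "x \<in> carrier G"
  shows "g \<otimes> x = x \<otimes> g \<longleftrightarrow> g \<otimes> x \<otimes> inv g = x"
proof
  assume "g \<otimes> x = x \<otimes> g"
  then show "g \<otimes> x \<otimes> inv g = x" using assms by (simp add: m_assoc)
next
  assume "g \<otimes> x \<otimes> inv g = x"
  then have "g \<otimes> x \<otimes> inv g \<otimes> g = x \<otimes> g" by simp
  then show "g \<otimes> x = x \<otimes> g" using assms by (simp add: m_assoc)
qed

lemma normal_centralizer:
  fixes G :: "'a monoid" (structure)
  assumes G: "group G" and K: "K \<lhd> G"
  shows "centralizer G K \<lhd> G"
proof -
  interpret group G by (rule G)
  interpret K: normal K G by (rule K)
  have sub: "subgroup (centralizer G K) G"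
  proof (rule subgroupI)
    have "\<one> \<in> centralizer G K" by (simp add: centralizer_def)
    then show "centralizer G K \<noteq> {}" by blast
  next
    fix a assume "a \<in> centralizer G K"
    then have a: "a \<in> carrier G" "\<And>k. k \<in> K \<Longrightarrow> a \<otimes> k = k \<otimes> a" by (auto simp: centralizer_def)
    have "inv a \<otimes> k = k \<otimes> inv a" if k: "k \<in> K" for k
    proof -
      have "inv a \<otimes> (a \<otimes> k) \<otimes> inv a = inv a \<otimes> (k \<otimes> a) \<otimes> inv a" using a(2)[OF k] by simp
      then show ?thesis using a(1) K.mem_carrier[OF k] by (simp add: m_assoc)
    qed
    then show "inv a \<in> centralizer G K" using a by (simp add: centralizer_def)
  next
    fix a b assume "a \<in> centralizer G K" "b \<in> centralizer G K"
    then have a: "a \<in> carrier G" "\<And>k. k \<in> K \<Longrightarrow> a \<otimes> k = k \<otimes> a"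
      and b: "b \<in> carrier G" "\<And>k. k \<in> K \<Longrightarrow> b \<otimes> k = k \<otimes> b" by (auto simp: centralizer_def)
    have "a \<otimes> b \<otimes> k = k \<otimes> (a \<otimes> b)" if k: "k \<in> K" for k
      using a b k K.mem_carrier[OF k] by (metis m_assoc)
    then show "a \<otimes> b \<in> centralizer G K" using a b by (simp add: centralizer_def)
  qed (auto simp: centralizer_def)
  show ?thesis
  proof (rule normal_invI[OF sub])
    fix x c assume x: "x \<in> carrier G" and "c \<in> centralizer G K"
    then have c: "c \<in> carrier G" "\<And>k. k \<in> K \<Longrightarrow> c \<otimes> k = k \<otimes> c" by (auto simp: centralizer_def)
    have "x \<otimes> c \<otimes> inv x \<otimes> k = k \<otimes> (x \<otimes> c \<otimes> inv x)" if k: "k \<in> K" for k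
    proof -
      define k' where "k' = inv x \<otimes> k \<otimes> x"
      have k': "k' \<in> K" "k' \<in> carrier G" using K.inv_op_closed1[OF x k] by (simp_all add: k'_def)
      have k_eq: "k = x \<otimes> k' \<otimes> inv x" using x K.mem_carrier[OF k] by (simp add: k'_def m_assoc)
      show ?thesis
        unfolding k_eq using x c(1) k'(2) conj_mult[of x c k'] conj_mult[of x k' c] c(2)[OF k'(1)] by simp
    qed
    then show "x \<otimes> c \<otimes> inv x \<in> centralizer G K" using x c by (simp add: centralizer_def)
  qed
qed

text \<open>Moving y past one factor x costs a factor c, and c commutes with the powers of x, so
  these factors collect. With x^n = 1 this yields c^n = 1.\<close>

lemma (in group) commutator_central:
  assumes x: "x \<in> carrier G" and y: "y \<in> carrier G"
    and c: "c = x \<otimes> y \<otimes> inv x \<otimes> inv y" and cx: "c \<otimes> x = x \<otimes> c"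
  shows "x [^] (n::nat) \<otimes> y = c [^] n \<otimes> (y \<otimes> x [^] n)"
proof (induction n)
  case (Suc n)
  have cc: "c \<in> carrier G" using x y c by simp
  have xy: "x \<otimes> y = c \<otimes> (y \<otimes> x)" using x y by (simp add: c m_assoc)
  have xc: "x [^] n \<otimes> c = c \<otimes> x [^] n" using group_commutes_pow[of x c n] x cc cx by simp
  have "x [^] Suc n \<otimes> y = x [^] n \<otimes> (c \<otimes> (y \<otimes> x))" using x y xy by (simp add: m_assoc)
  also have "\<dots> = (x [^] n \<otimes> c) \<otimes> (y \<otimes> x)" using x y cc by (simp add: m_assoc)
  also have "\<dots> = c \<otimes> (x [^] n \<otimes> y) \<otimes> x" using x y cc xc by (simp add: m_assoc)
  also have "\<dots> = c \<otimes> c [^] n \<otimes> (y \<otimes> x [^] Suc n)" using x y cc Suc by (simp add: m_assoc)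
  also have "c \<otimes> c [^] n = c [^] Suc n" using cc nat_pow_Suc2 by simp
  finally show ?case .
qed (use x y in simp)

text \<open>
  A derived term of the centralizer with abelian image modulo the \<open>\<pi>'\<close>-core has class at most two.
  Its \<open>\<pi>\<close>-elements commute, because a commutator has order dividing both a \<open>\<pi>\<close>-number and a
  \<open>\<pi>'\<close>-number, and so they form a normal \<open>\<pi>\<close>-subgroup.
\<close>

lemma (in finite_group) centralizer_O_pi_compl_subset:
  assumes solv: "solvable G"
    and red: "\<And>N. N \<lhd> G \<Longrightarrow> pi_number \<pi> (card N) \<Longrightarrow> N = {\<one>}"
  shows "centralizer G (O_pi (- \<pi>) G) \<subseteq> O_pi (- \<pi>) G"
proof (rule ccontr)
  define K where "K = O_pi (- \<pi>) G"
  define C where "C = centralizer G K"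
  assume "\<not> ?thesis"
  then have CK: "\<not> C \<subseteq> K" by (simp add: C_def K_def)
  have KG: "K \<lhd> G" and Kpi: "pi_number (- \<pi>) (card K)"
    by (simp_all add: K_def O_pi_normal O_pi_pi_number)
  have Ksub: "subgroup K G" using KG by (rule normal_imp_subgroup)
  have CG: "C \<lhd> G" unfolding C_def using KG is_group by (rule normal_centralizer[rotated])
  define D where "D n = (derived G ^^ n) C" for n
  have D0: "D 0 = C" and DS: "D (Suc n) = derived G (D n)" for n by (simp_all add: D_def)
  have DG: "D n \<lhd> G" for n
    by (induction n) (simp_all add: D0 DS CG derived_is_normal)
  have DC: "D n \<subseteq> C" for n
    by (induction n) (simp_all add: D0 DS derived_incl[OF _ normal_imp_subgroup[OF CG]])
  obtain n where n: "(derived G ^^ n) (carrier G) = {\<one>}"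
    using solv solvable_iff_trivial_derived_seq by blast
  have "D n \<subseteq> {\<one>}"
    using mono_exp_of_derived[OF normal_imp_subgroup[OF CG, THEN subgroup.subset], of n] n
    by (simp add: D_def)
  then have "\<exists>n. D n \<subseteq> K" using subgroup.one_closed[OF Ksub] by blast
  moreover have "\<not> D 0 \<subseteq> K" using CK by (simp add: D0)
  \<comment> \<open>Here the derived series of \<open>C\<close> drops into \<open>K\<close>:
    commutators of elements of \<open>D m\<close> lie in \<open>K\<close>, which \<open>D m\<close>
    centralizes.\<close>
  ultimately obtain m where m: "\<not> D m \<subseteq> K" "D (Suc m) \<subseteq> K"
    using inc_induct[of 0 _ "\<lambda>n. D n \<subseteq> K"] by (metis zero_le)
  define E where "E = D m"
  have EG: "E \<lhd> G" using DG by (simp add: E_def)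
  have Esub: "subgroup E G" using EG by (rule normal_imp_subgroup)
  have EC: "x \<in> carrier G" "k \<in> K \<Longrightarrow> x \<otimes> k = k \<otimes> x" if "x \<in> E" for x k
    using DC[of m] that by (auto simp: E_def C_def centralizer_def)
  have EK: "derived G E \<subseteq> K" using m by (simp add: E_def DS)
  define T where "T = {x \<in> E. \<exists>n>0. pi_number \<pi> n \<and> x [^] (n::nat) = \<one>}"
  have comm: "x \<otimes> y = y \<otimes> x" if x: "x \<in> T" and y: "y \<in> E" for x y
  proof -
    from x have xE: "x \<in> E" by (simp add: T_def)
    note xc = EC(1)[OF xE] and yc = EC(1)[OF y]
    obtain n :: nat where n: "n > 0" "pi_number \<pi> n" "x [^] n = \<one>" using x by (auto simp: T_def)
    define c where "c = x \<otimes> y \<otimes> inv x \<otimes> inv y"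
    have "c \<in> derived_set G E" using xE y by (auto simp: c_def)
    then have "c \<in> derived G E" unfolding derived_def by (rule generate.incl)
    then have cK: "c \<in> K" using EK by blast
    have cc: "c \<in> carrier G" using xc yc by (simp add: c_def)
    have "x [^] n \<otimes> y = c [^] n \<otimes> (y \<otimes> x [^] n)"
      using commutator_central[OF xc yc c_def] EC(2)[OF xE cK] by simp
    then have "c [^] n = \<one>" using n yc cc by (simp add: r_cancel_one')
    then have "ord c dvd n" using pow_eq_id[OF cc] by simp
    moreover have "ord c dvd card K" using ord_subgroup_dvd[OF fin Ksub cK] .
    ultimately have "ord c dvd 1"
      using pi_number_coprime[OF n(2) Kpi n(1) card_subgroup_pos[OF fin Ksub]]
      by (meson coprime_common_divisor)
    then have "c = \<one>" using ord_eq_1[OF cc] by simp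
    then show ?thesis using xc yc unfolding c_def
      by (metis inv_equality inv_inv inv_closed m_closed inv_solve_right' l_one)
  qed
  have Tsub: "subgroup T G"
  proof (rule subgroupI)
    show "T \<subseteq> carrier G" using EC(1) by (auto simp: T_def)
    have "\<one> \<in> T" using subgroup.one_closed[OF Esub] by (auto simp: T_def intro!: exI[of _ "Suc 0"])
    then show "T \<noteq> {}" by blast
  next
    fix x assume x: "x \<in> T"
    then show "inv x \<in> T"
      using EC(1) subgroup.m_inv_closed[OF Esub] by (auto simp: T_def nat_pow_inv)
  next
    fix x y assume x: "x \<in> T" and y: "y \<in> T"
    then have xy: "x \<in> E" "y \<in> E" by (auto simp: T_def)
    obtain i j :: nat where ij: "i > 0" "pi_number \<pi> i" "x [^] i = \<one>" "j > 0" "pi_number \<pi> j" "y [^] j = \<one>"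
      using x y by (auto simp: T_def)
    have "(x \<otimes> y) [^] (i * j) = x [^] (i * j) \<otimes> y [^] (i * j)"
      using pow_mult_distrib[OF comm[OF x xy(2)]] EC(1) xy by simp
    also have "\<dots> = (x [^] i) [^] j \<otimes> (y [^] j) [^] i"
      using EC(1) xy by (simp add: nat_pow_pow mult.commute)
    also have "\<dots> = \<one>" using ij by simp
    finally show "x \<otimes> y \<in> T"
      using ij subgroup.m_closed[OF Esub xy] pi_number_mult[OF ij(2,5)]
      by (auto simp: T_def intro!: exI[of _ "i * j"])
  qed
  have TG: "T \<lhd> G"
  proof (rule normal_invI[OF Tsub])
    fix g x assume g: "g \<in> carrier G" and x: "x \<in> T"
    then obtain n :: nat where n: "n > 0" "pi_number \<pi> n" "x [^] n = \<one>" by (auto simp: T_def)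
    have xE: "x \<in> E" using x by (simp add: T_def)
    have "(g \<otimes> x \<otimes> inv g) [^] n = \<one>" using conj_nat_pow[OF g EC(1)[OF xE], of n] n g by simp
    then show "g \<otimes> x \<otimes> inv g \<in> T"
      using n normal.inv_op_closed2[OF EG g xE] by (auto simp: T_def)
  qed
  have "pi_number \<pi> (card T)"
    by (rule pi_number_card_subgroupI[OF fin Tsub]) (simp add: T_def)
  then have T1: "T = {\<one>}" using red[OF TG] by simp
  \<comment> \<open>With \<open>T\<close> trivial, Cauchy leaves no prime of \<pi> in the order of
    \<open>E\<close>, so \<open>E\<close> falls into \<open>K\<close>, against the choice of
    \<open>m\<close>.\<close>
  have "pi_number (- \<pi>) (card E)"
    unfolding pi_number_def
  proof
    fix q assume "q \<in> prime_factors (card E)"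
    then have q: "prime q" "q dvd card E" by (auto simp: in_prime_factors_iff)
    show "q \<in> - \<pi>"
    proof
      assume "q \<in> \<pi>"
      obtain x where x: "x \<in> E" "ord x = q" using cauchy[OF fin Esub q] by blast
      have "pi_number \<pi> q" using q(1) \<open>q \<in> \<pi>\<close> by (simp add: pi_number_def prime_prime_factors)
      moreover have "x [^] q = \<one>" using pow_ord_eq_1[OF EC(1)[OF x(1)]] x by simp
      ultimately have "x \<in> T" using x q by (auto simp: T_def intro!: exI[of _ q] prime_gt_0_nat)
      then have "x = \<one>" using T1 by simp
      then show False using x(2) q(1) by auto
    qed
  qed
  then have "E \<subseteq> K" using O_pi_greatest[OF EG] by (simp add: K_def)
  then show False using m by (simp add: E_def)
qed


section \<open>Recognizing the dipole groups\<close>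

lemma (in group) involution_inv:
  assumes "y \<in> carrier G" "y \<otimes> y = \<one>"
  shows "inv y = y"
  using assms by (simp add: inv_equality)

lemma (in group) conj_int_pow:
  assumes g: "g \<in> carrier G" and x: "x \<in> carrier G"
  shows "(g \<otimes> x \<otimes> inv g) [^] (n::int) = g \<otimes> x [^] n \<otimes> inv g"
proof (cases n)
  case (nonneg k)
  then show ?thesis using assms by (simp add: int_pow_int conj_nat_pow)
next
  case (neg k)
  have "(g \<otimes> x \<otimes> inv g) [^] n = inv (g \<otimes> x [^] Suc k \<otimes> inv g)"
    unfolding neg int_pow_neg_int[OF m_closed[OF m_closed[OF g x] inv_closed[OF g]]]
      conj_nat_pow[OF g x] ..
  also have "\<dots> = g \<otimes> inv (x [^] Suc k) \<otimes> inv g"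
    using assms by (simp add: inv_mult_group m_assoc del: nat_pow_Suc)
  finally show ?thesis unfolding neg int_pow_neg_int[OF x] .
qed

lemma (in group) int_pow_mod_ord:
  assumes "x \<in> carrier G"
  shows "x [^] (k mod int (ord x)) = x [^] k"
  using assms by (simp add: int_pow_eq)

text \<open>Conjugating twice by y restores x, so x^(e^2) = x.\<close>

lemma (in group) conj_square_cong:
  fixes e :: int
  assumes x: "x \<in> carrier G" and y: "y \<in> carrier G" "y \<otimes> y = \<one>"
    and conj: "y \<otimes> x \<otimes> y = x [^] e"
  shows "[e ^ 2 = 1] (mod int (ord x))"
proof -
  have iy: "inv y = y" using y by (rule involution_inv)
  have "x [^] (e * e) = (y \<otimes> x \<otimes> inv y) [^] e"
    using x conj by (simp add: iy int_pow_pow)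
  also have "\<dots> = y \<otimes> (y \<otimes> x \<otimes> y) \<otimes> inv y"
    unfolding conj_int_pow[OF y(1) x] conj ..
  also have "\<dots> = x [^] (1::int)"
    using x y inv_mult_cancel[of y x] by (simp add: iy m_assoc)
  finally have "int (ord x) dvd 1 - e * e" using int_pow_eq[OF x] by blast
  then show ?thesis
    by (metis cong_iff_dvd_diff cong_sym power2_eq_square)
qed

text \<open>The map is built in the opposite direction, (i, b) going to x^i y^b, because elements of
  the dipole group come in normal form. It is multiplicative since y x^j = x^(e j) y, injective
  since y is no power of x, and surjective since its image contains x and y. Its inverse is
  returned.\<close>

lemma (in group) dipole_iso:
  fixes e :: int
  assumes fin: "finite (carrier G)"
    and x: "x \<in> carrier G" and y: "y \<in> carrier G" "y \<otimes> y = \<one>"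
    and conj: "y \<otimes> x \<otimes> y = x [^] e"
    and nin: "y \<notin> generate G {x}" and gen: "generate G {x, y} = carrier G"
  obtains h where "h \<in> iso G (dipole_group (ord x) e)" "h x = dipole_x (ord x)" "h y = dipole_y"
proof -
  let ?m = "ord x"
  let ?D = "dipole_group ?m e"
  have m: "?m > 0" using ord_ge_1[OF fin x] by simp
  have e2: "[e ^ 2 = 1] (mod int ?m)" by (rule conj_square_cong[OF x y conj])
  interpret D: group ?D by (rule group_dipole_group[OF m e2])
  have iy: "inv y = y" using y by (rule involution_inv)
  define f where "f = (\<lambda>(i::int, b). x [^] i \<otimes> (if b then y else \<one>))"
  have yx: "y \<otimes> x [^] j = x [^] (e * j) \<otimes> y" for j :: int
  proof -
    have "y \<otimes> x [^] j \<otimes> inv y = x [^] (e * j)"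
      using conj_int_pow[OF y(1) x, of j] conj x by (simp add: iy int_pow_pow)
    then have "y \<otimes> x [^] j \<otimes> inv y \<otimes> y = x [^] (e * j) \<otimes> y" by simp
    then show ?thesis using x y(1) by (simp add: m_assoc)
  qed
  have hom: "f \<in> hom ?D G"
  proof (rule homI)
    fix a assume "a \<in> carrier ?D"
    then show "f a \<in> carrier G" using x y by (cases a) (simp add: f_def)
  next
    fix a b assume "a \<in> carrier ?D" "b \<in> carrier ?D"
    obtain i c j d where ab: "a = (i, c)" "b = (j, d)" by (cases a, cases b)
    have yy: "y \<otimes> (y \<otimes> z) = z" if "z \<in> carrier G" for z
      using that y by (metis m_assoc l_one)
    have 1: "x [^] i \<otimes> (y \<otimes> (x [^] j \<otimes> z)) = x [^] (i + e * j) \<otimes> (y \<otimes> z)" if "z \<in> carrier G" for z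
    proof -
      have "x [^] i \<otimes> (y \<otimes> (x [^] j \<otimes> z)) = x [^] i \<otimes> ((y \<otimes> x [^] j) \<otimes> z)"
        using that x y by (simp add: m_assoc)
      also have "\<dots> = x [^] (i + e * j) \<otimes> (y \<otimes> z)"
        unfolding yx using that x y by (simp add: m_assoc int_pow_mult)
      finally show ?thesis .
    qed
    have 2: "x [^] i \<otimes> (x [^] j \<otimes> z) = x [^] (i + j) \<otimes> z" if "z \<in> carrier G" for z
      using that x by (simp add: int_pow_mult m_assoc)
    show "f (a \<otimes>\<^bsub>?D\<^esub> b) = f a \<otimes> f b"
      using x y 1[of \<one>] 1[of y] 2[of \<one>] 2[of y]
      by (cases c; cases d) (simp_all add: ab f_def dipole_group_def int_pow_mod_ord m_assoc)
  qed
  interpret f: group_hom ?D G f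
    using hom by (simp add: group_hom_def group_hom_axioms_def D.is_group is_group)
  have fx: "f (dipole_x ?m) = x"
    using x by (simp add: f_def dipole_x_def int_pow_mod_ord)
  have fy: "f dipole_y = y" using y by (simp add: f_def dipole_y_def)
  have xD: "dipole_x ?m \<in> carrier ?D" and yD: "dipole_y \<in> carrier ?D"
    using m by (auto simp: dipole_x_def dipole_y_def dipole_group_def)
  have inj: "inj_on f (carrier ?D)"
  proof (rule f.trivial_ker_imp_inj)
    have "a = \<one>\<^bsub>?D\<^esub>" if a: "a \<in> carrier ?D" "f a = \<one>" for a
    proof -
      obtain i b where ib: "a = (i, b)" by (cases a)
      have i: "0 \<le> i" "i < int ?m" using a by (auto simp: ib dipole_group_def)
      have "\<not> b"
      proof
        assume b
        then have "x [^] i \<otimes> y = \<one>" using a by (simp add: ib f_def)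
        then have "y = inv (x [^] i)" using x y by (metis inv_comm inv_equality int_pow_closed)
        also have "\<dots> = x [^] (- i)" using x by (simp add: int_pow_neg)
        finally show False using nin generate_pow[OF x] by blast
      qed
      then have "x [^] i = \<one>" using a x by (simp add: ib f_def)
      then have "int ?m dvd i" using int_pow_eq_id[OF x] by simp
      then have "i = 0" using i zdvd_not_zless[of i "int ?m"] by linarith
      then show ?thesis using \<open>\<not> b\<close> by (simp add: ib dipole_group_def)
    qed
    then show "kernel ?D G f = {\<one>\<^bsub>?D\<^esub>}" by (auto simp: kernel_def)
  qed
  have sub: "subgroup (f ` carrier ?D) G" by (rule f.img_is_subgroup)
  have "{x, y} \<subseteq> f ` carrier ?D" using fx fy xD yD by (metis empty_subsetI image_eqI insert_subset)
  then have "carrier G \<subseteq> f ` carrier ?D" using generate_subgroup_incl[OF _ sub] gen by blast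
  then have "f ` carrier ?D = carrier G" using subgroup.subset[OF sub] by blast
  then have iso: "f \<in> iso ?D G" using hom inj by (simp add: iso_def bij_betw_def)
  have "inv_into (carrier ?D) f \<in> iso G ?D" by (rule D.iso_set_sym[OF iso])
  moreover have "inv_into (carrier ?D) f x = dipole_x ?m" "inv_into (carrier ?D) f y = dipole_y"
    using inv_into_f_f[OF inj xD] inv_into_f_f[OF inj yD] by (simp_all add: fx fy)
  ultimately show thesis by (rule that)
qed

lemma order_dipole_group [simp]: "order (dipole_group m e) = 2 * m"
  by (simp add: order_def dipole_group_def card_cartesian_product)

text \<open>Normality supplies the exponent e. As x and y do not commute, y is no power of x and e
  is not 1 modulo \<open>ord x\<close>. The latter excludes \<open>ord x = 1\<close>, and oddness
  excludes 2.\<close>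

lemma (in finite_group) is_D_I:
  assumes x: "x \<in> carrier G" and y: "y \<in> carrier G" "y \<otimes> y = \<one>"
    and norm: "generate G {x} \<lhd> G" and gen: "generate G {x, y} = carrier G"
    and nc: "x \<otimes> y \<noteq> y \<otimes> x"
  shows "order G = 2 * ord x"
    and "odd (ord x) \<Longrightarrow> \<exists>m e. 3 \<le> m \<and> odd m \<and> [e ^ 2 = 1] (mod int m) \<and> \<not> [e = 1] (mod int m) \<and>
           is_D (ORMap G x y) m e"
proof -
  let ?m = "ord x"
  have iy: "inv y = y" using y by (rule involution_inv)
  have "y \<otimes> x \<otimes> inv y \<in> generate G {x}"
    using normal.inv_op_closed2[OF norm y(1)] generate.incl[of x "{x}" G] by simp
  then obtain e :: int where e: "y \<otimes> x \<otimes> y = x [^] e"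
    using generate_pow[OF x] iy by auto
  have nin: "y \<notin> generate G {x}"
  proof
    assume "y \<in> generate G {x}"
    then obtain k :: int where "y = x [^] k" using generate_pow[OF x] by blast
    then have "x \<otimes> y = y \<otimes> x"
      using x int_pow_mult[OF x, of 1 k] int_pow_mult[OF x, of k 1] by (simp add: add.commute)
    with nc show False ..
  qed
  obtain h where h: "h \<in> iso G (dipole_group ?m e)" "h x = dipole_x ?m" "h y = dipole_y"
    using dipole_iso[OF fin x y e nin gen] by blast
  have e2: "[e ^ 2 = 1] (mod int ?m)" by (rule conj_square_cong[OF x y e])
  have ne1: "\<not> [e = 1] (mod int ?m)"
  proof
    assume "[e = 1] (mod int ?m)"
    then have "int ?m dvd 1 - e" by (metis cong_iff_dvd_diff cong_sym)
    then have "x [^] e = x [^] (1::int)" using int_pow_eq[OF x] by blast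
    then have "y \<otimes> x \<otimes> inv y = x" using e x iy by simp
    then show False using nc commute_iff_conj[OF y(1) x] by simp
  qed
  have m: "?m > 0" using ord_ge_1[OF fin x] by simp
  have D: "group (dipole_group ?m e)" by (rule group_dipole_group[OF m e2])
  interpret h: group_hom G "dipole_group ?m e" h
    using h(1) D by (simp add: group_hom_def group_hom_axioms_def is_group iso_def)
  have inv: "involution (dipole_group ?m e) dipole_y"
    using m by (simp add: involution_def dipole_y_def dipole_group_def)
  have "dipole_y \<notin> generate (dipole_group ?m e) {dipole_x ?m}"
  proof
    assume "dipole_y \<in> generate (dipole_group ?m e) {dipole_x ?m}"
    then have "h y \<in> h ` generate G {x}" using h.generate_img[of "{x}"] x h by simp
    moreover have "inj_on h (carrier G)" using h(1) by (simp add: iso_def bij_betw_def)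
    ultimately have "y \<in> generate G {x}"
      using y generate_incl[of "{x}"] x by (auto simp: inj_on_def)
    with nin show False ..
  qed
  moreover have "map_iso (ORMap G x y) (ORMap (dipole_group ?m e) (dipole_x ?m) dipole_y)"
    using h by auto
  ultimately have D: "is_D (ORMap G x y) ?m e" unfolding is_D_def using inv by blast
  show "\<exists>m e. 3 \<le> m \<and> odd m \<and> [e ^ 2 = 1] (mod int m) \<and> \<not> [e = 1] (mod int m) \<and>
           is_D (ORMap G x y) m e" if odd: "odd (ord x)"
  proof -
    have "?m \<noteq> 1" using ne1 by (auto simp: cong_def)
    moreover have "?m \<noteq> 2" using odd by auto
    ultimately have "3 \<le> ?m" using m by simp
    then show ?thesis using odd e2 ne1 D by blast
  qed
  show "order G = 2 * ?m"
    using iso_same_card[OF is_isoI[OF h(1)]] order_dipole_group by (simp add: order_def)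
qed

text \<open>The rotation is taken as \<open>r \<otimes> t\<close>, not \<open>t \<otimes> r\<close>,
  so that \<open>r\<close> is the rotation times \<open>t\<close>, in agreement with
  \<open>dihedral_r\<close>. Conjugation by \<open>t\<close> inverts it, whence the exponent
  -1.\<close>

lemma (in finite_group) dihedral_iso:
  assumes t: "t \<in> carrier G" "t \<otimes> t = \<one>" and r: "r \<in> carrier G" "r \<otimes> r = \<one>"
    and gen: "generate G {t, r} = carrier G" and nin: "t \<notin> generate G {r \<otimes> t}"
  obtains m h where "m \<ge> 1" "h \<in> iso G (dipole_group m (- 1))"
    "h t = dihedral_t" "h r = dihedral_r m"
    "h \<one> = \<one>\<^bsub>dipole_group m (- 1)\<^esub>"
proof -
  let ?x = "r \<otimes> t"
  have it: "inv t = t" and ir: "inv r = r" using t r by (simp_all add: involution_inv)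
  have x: "?x \<in> carrier G" using t r by simp
  have xt: "?x \<otimes> t = r" using t r by (simp add: m_assoc)
  have "t \<otimes> ?x \<otimes> t = t \<otimes> r" using t r by (simp add: m_assoc)
  also have "\<dots> = ?x [^] (- 1 :: int)" using t r it ir by (simp add: int_pow_neg inv_mult_group)
  finally have conj: "t \<otimes> ?x \<otimes> t = ?x [^] (- 1 :: int)" .
  have subx: "subgroup (generate G {?x, t}) G" by (rule generate_is_subgroup) (use x t in auto)
  have "?x \<otimes> t \<in> generate G {?x, t}" by (rule generate.eng) (auto intro: generate.incl)
  then have "{t, r} \<subseteq> generate G {?x, t}" using xt by (auto intro: generate.incl)
  then have "carrier G \<subseteq> generate G {?x, t}" using generate_subgroup_incl[OF _ subx] gen by blast
  then have genx: "generate G {?x, t} = carrier G" using subgroup.subset[OF subx] by blast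
  obtain h where h: "h \<in> iso G (dipole_group (ord ?x) (- 1))" "h ?x = dipole_x (ord ?x)" "h t = dipole_y"
    using dipole_iso[OF fin x t conj nin genx] by blast
  let ?D = "dipole_group (ord ?x) (- 1)"
  have m: "ord ?x \<ge> 1" using ord_ge_1[OF fin x] .
  have D: "group ?D" by (rule group_dipole_group) (use m in \<open>auto simp: cong_def\<close>)
  interpret h: group_hom G ?D h
    using h(1) D by (simp add: group_hom_def group_hom_axioms_def is_group iso_def)
  have "h r = h ?x \<otimes>\<^bsub>?D\<^esub> h t" using h.hom_mult[OF x t(1)] xt by simp
  then have "h r = dihedral_r (ord ?x)"
    by (simp add: h dihedral_r_def dipole_x_def dipole_y_def dipole_group_def)
  with that[of "ord ?x" h] m h h.hom_one show thesis by (simp add: dihedral_t_def)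
qed


section \<open>Groups generated by involutions\<close>

text \<open>As \<open>t\<close> normalizes \<open>A\<close> and squares to one, the union of
  \<open>A\<close> and its coset by \<open>t\<close> is a subgroup;
  \<open>g \<otimes> t \<in> A\<close> expresses membership in that coset. It is applied with
  \<open>A\<close> the even part, the rotations at a vertex, and the core.\<close>

lemma (in group) generate_subset_two_cosets:
  assumes A: "subgroup A G" and t: "t \<in> carrier G" "t \<otimes> t = \<one>"
    and conj: "\<And>a. a \<in> A \<Longrightarrow> t \<otimes> a \<otimes> t \<in> A"
    and S: "\<And>s. s \<in> S \<Longrightarrow> s \<in> carrier G \<and> (s \<in> A \<or> s \<otimes> t \<in> A)"
    and g: "g \<in> generate G S"
  shows "g \<in> A \<or> g \<otimes> t \<in> A"
proof -
  note Ac = subgroup.mem_carrier[OF A]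
  have it: "inv t = t" using t by (rule involution_inv)
  have tt: "t \<otimes> (t \<otimes> z) = z" if "z \<in> carrier G" for z using that t by (metis m_assoc l_one)
  have inv_case: "inv s \<in> A \<or> inv s \<otimes> t \<in> A" if s: "s \<in> carrier G" "s \<in> A \<or> s \<otimes> t \<in> A" for s
    using s(2)
  proof
    assume "s \<otimes> t \<in> A"
    then have "t \<otimes> inv (s \<otimes> t) \<otimes> t \<in> A" using conj subgroup.m_inv_closed[OF A] by blast
    moreover have "t \<otimes> inv (s \<otimes> t) \<otimes> t = inv s \<otimes> t"
      using s(1) t by (simp add: inv_mult_group it m_assoc tt)
    ultimately show ?thesis by simp
  qed (use subgroup.m_inv_closed[OF A] in blast)
  have "g \<in> carrier G \<and> (g \<in> A \<or> g \<otimes> t \<in> A)"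
    using g
  proof induction
    case one
    then show ?case using subgroup.one_closed[OF A] by simp
  next
    case (incl h)
    then show ?case using S by blast
  next
    case (inv h)
    then show ?case using S inv_case by blast
  next
    case (eng g h)
    then have c: "g \<in> carrier G" "h \<in> carrier G" by auto
    from eng have "(g \<in> A \<or> g \<otimes> t \<in> A)" "(h \<in> A \<or> h \<otimes> t \<in> A)" by auto
    then consider "g \<in> A" "h \<in> A" | "g \<in> A" "h \<otimes> t \<in> A" | "g \<otimes> t \<in> A" "h \<in> A"
      | "g \<otimes> t \<in> A" "h \<otimes> t \<in> A" by blast
    then have "g \<otimes> h \<in> A \<or> g \<otimes> h \<otimes> t \<in> A"
    proof cases
      case 1
      then show ?thesis using subgroup.m_closed[OF A] by blast
    next
      case 2
      then have "g \<otimes> (h \<otimes> t) \<in> A" using subgroup.m_closed[OF A] by blast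
      then show ?thesis using c t by (simp add: m_assoc)
    next
      case 3
      then have "(g \<otimes> t) \<otimes> (t \<otimes> h \<otimes> t) \<in> A" using subgroup.m_closed[OF A] conj by blast
      then show ?thesis using c t by (simp add: m_assoc tt)
    next
      case 4
      then have "(g \<otimes> t) \<otimes> (t \<otimes> (h \<otimes> t) \<otimes> t) \<in> A" using subgroup.m_closed[OF A] conj by blast
      then show ?thesis using c t by (simp add: m_assoc tt)
    qed
    then show ?case using c by simp
  qed
  then show ?thesis by simp
qed

text \<open>The generators are only required to square to one, so that the locale passes to
  quotients in which some of them collapse.\<close>

locale generated_by_involutions = finite_group +
  fixes t r l
  assumes t: "t \<in> carrier G" "t \<otimes> t = \<one>"
    and r: "r \<in> carrier G" "r \<otimes> r = \<one>"
    and l: "l \<in> carrier G" "l \<otimes> l = \<one>"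
    and tl: "t \<otimes> l = l \<otimes> t"
    and gen: "generate G {t, r, l} = carrier G"
begin

abbreviation even_part :: "'a set" where
  "even_part \<equiv> generate G {t \<otimes> r, r \<otimes> l}"

abbreviation rot :: "'a set" where
  "rot \<equiv> generate G {t \<otimes> r}"

lemma inv_gens [simp]: "inv t = t" "inv r = r" "inv l = l"
  using t r l by (simp_all add: involution_inv)

lemma cancel_gens [simp]:
  assumes "z \<in> carrier G"
  shows "t \<otimes> (t \<otimes> z) = z" "r \<otimes> (r \<otimes> z) = z" "l \<otimes> (l \<otimes> z) = z"
  using assms t r l by (metis m_assoc l_one)+

lemma subgroup_even: "subgroup even_part G"
  by (rule generate_is_subgroup) (use t r l in auto)

lemma subgroup_rot: "subgroup rot G"
  by (rule generate_is_subgroup) (use t r in auto)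

lemma tr_even: "t \<otimes> r \<in> even_part" and rl_even: "r \<otimes> l \<in> even_part"
  by (auto intro: generate.incl)

lemma tl_even: "t \<otimes> l \<in> even_part"
proof -
  have "t \<otimes> l = (t \<otimes> r) \<otimes> (r \<otimes> l)" using t r l by (simp add: m_assoc)
  then show ?thesis using generate.eng[OF tr_even rl_even] by simp
qed

lemma tl_square: "t \<otimes> l \<otimes> (t \<otimes> l) = \<one>"
proof -
  have "t \<otimes> l \<otimes> (t \<otimes> l) = t \<otimes> l \<otimes> (l \<otimes> t)" using tl by simp
  then show ?thesis using t l by (simp add: m_assoc)
qed

lemma rt_even: "r \<otimes> t \<in> even_part"
  using subgroup.m_inv_closed[OF subgroup_even tr_even] t r by (simp add: inv_mult_group)

text \<open>Conjugation by \<open>t\<close> inverts t r and, because t and l commute, sends r l to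
  (t r)(t l).\<close>

lemma conj_t_even: "g \<in> even_part \<Longrightarrow> t \<otimes> g \<otimes> t \<in> even_part"
proof (induction rule: generate.induct)
  case one
  then show ?case using t generate.one by simp
next
  case (incl h)
  have "t \<otimes> (r \<otimes> l) \<otimes> t = (t \<otimes> r) \<otimes> (t \<otimes> l)" using t r l tl by (simp add: m_assoc)
  then have "t \<otimes> (r \<otimes> l) \<otimes> t \<in> even_part" using generate.eng[OF tr_even tl_even] by simp
  moreover have "t \<otimes> (t \<otimes> r) \<otimes> t \<in> even_part" using rt_even t r by simp
  ultimately show ?case using incl by auto
next
  case (inv h)
  have "inv (t \<otimes> (r \<otimes> l) \<otimes> t) = inv ((t \<otimes> r) \<otimes> (t \<otimes> l))" using t r l tl by (simp add: m_assoc)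
  then have "t \<otimes> inv (r \<otimes> l) \<otimes> t = inv ((t \<otimes> r) \<otimes> (t \<otimes> l))"
    using t r l by (simp add: inv_mult_group m_assoc)
  then have "t \<otimes> inv (r \<otimes> l) \<otimes> t \<in> even_part"
    using subgroup.m_inv_closed[OF subgroup_even generate.eng[OF tr_even tl_even]] by simp
  moreover have "t \<otimes> inv (t \<otimes> r) \<otimes> t \<in> even_part" using tr_even t r by (simp add: inv_mult_group m_assoc)
  ultimately show ?case using inv by auto
next
  case (eng g h)
  then have c: "g \<in> carrier G" "h \<in> carrier G"
    using subgroup.mem_carrier[OF subgroup_even] by auto
  have "t \<otimes> (g \<otimes> h) \<otimes> t = (t \<otimes> g \<otimes> t) \<otimes> (t \<otimes> h \<otimes> t)" using c t by (simp add: m_assoc)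
  then show ?case using generate.eng[OF eng(3,4)] by simp
qed

lemma even_cosets:
  assumes "g \<in> carrier G"
  shows "g \<in> even_part \<or> g \<otimes> t \<in> even_part"
proof (rule generate_subset_two_cosets[OF subgroup_even t conj_t_even])
  show "g \<in> generate G {t, r, l}" using assms gen by simp
  fix s assume "s \<in> {t, r, l}"
  then show "s \<in> carrier G \<and> (s \<in> even_part \<or> s \<otimes> t \<in> even_part)"
    using t r l generate.one[of G] rt_even tl_even tl by auto
qed

lemma mult_odd_even:
  assumes "g \<in> carrier G" "h \<in> carrier G" "g \<notin> even_part" "h \<notin> even_part"
  shows "g \<otimes> h \<in> even_part"
proof -
  have "(g \<otimes> t) \<otimes> (t \<otimes> (h \<otimes> t) \<otimes> t) \<in> even_part"
    using even_cosets assms conj_t_even generate.eng by metis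
  then show ?thesis using assms t by (simp add: m_assoc)
qed

lemma card_rcosets_even: "card (rcosets even_part) = (if t \<in> even_part then 1 else 2)"
proof -
  have c: "even_part #> g \<in> {even_part, even_part #> t}" if g: "g \<in> carrier G" for g
    using even_cosets[OF g]
  proof
    assume "g \<in> even_part"
    then show ?thesis using coset_join2[OF g subgroup_even] by simp
  next
    assume "g \<otimes> t \<in> even_part"
    then have "even_part #> (g \<otimes> t) = even_part" using coset_join2[OF _ subgroup_even] g t by simp
    then have "even_part #> (g \<otimes> t) #> t = even_part #> t" by simp
    then show ?thesis
      using g t subgroup.subset[OF subgroup_even] by (simp add: coset_mult_assoc m_assoc)
  qed
  have 1: "even_part #> \<one> = even_part" using subgroup.subset[OF subgroup_even] by simp
  have "rcosets even_part = {even_part, even_part #> t}"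
  proof
    show "rcosets even_part \<subseteq> {even_part, even_part #> t}" using c by (auto simp: RCOSETS_def)
    have "even_part #> \<one> \<in> rcosets even_part" "even_part #> t \<in> rcosets even_part"
      using t by (auto simp: RCOSETS_def)
    then show "{even_part, even_part #> t} \<subseteq> rcosets even_part" using 1 by simp
  qed
  moreover have "even_part = even_part #> t \<longleftrightarrow> t \<in> even_part"
    using coset_join1[OF _ t(1) subgroup_even] coset_join2[OF t(1) subgroup_even] by metis
  ultimately show ?thesis by (auto simp: card_insert_if)
qed

lemma orientable_iff: "orientable (RegMap G t r l) \<longleftrightarrow> t \<notin> even_part"
  using card_rcosets_even by simp

lemma conj_t_rot:
  assumes "z \<in> rot"
  shows "t \<otimes> z \<otimes> t = inv z"
proof -
  obtain k :: int where k: "z = (t \<otimes> r) [^] k" using assms generate_pow[of "t \<otimes> r"] t r by auto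
  have "t \<otimes> z \<otimes> inv t = (t \<otimes> (t \<otimes> r) \<otimes> inv t) [^] k"
    unfolding k using conj_int_pow[OF t(1), of "t \<otimes> r" k] t r by simp
  also have "t \<otimes> (t \<otimes> r) \<otimes> inv t = inv (t \<otimes> r)" using t r by (simp add: inv_mult_group)
  also have "inv (t \<otimes> r) [^] k = inv z" unfolding k using t r by (simp add: int_pow_inv)
  finally show ?thesis by simp
qed

lemma rot_commute:
  assumes "y \<in> rot" "z \<in> rot"
  shows "y \<otimes> z = z \<otimes> y"
proof -
  have tr: "t \<otimes> r \<in> carrier G" using t r by simp
  obtain j k :: int where "y = (t \<otimes> r) [^] j" "z = (t \<otimes> r) [^] k"
    using assms generate_pow[OF tr] by auto
  then show ?thesis using tr by (simp add: int_pow_mult[symmetric] add.commute)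
qed

lemma stabilizer_cosets:
  assumes "g \<in> generate G {t, r}"
  shows "g \<in> rot \<or> g \<otimes> t \<in> rot"
proof (rule generate_subset_two_cosets[OF subgroup_rot t _ _ assms])
  show "t \<otimes> a \<otimes> t \<in> rot" if "a \<in> rot" for a
    using that subgroup.m_inv_closed[OF subgroup_rot] by (simp add: conj_t_rot)
  have "r \<otimes> t = inv (t \<otimes> r)" using t r by (simp add: inv_mult_group)
  then have "r \<otimes> t \<in> rot"
    using subgroup.m_inv_closed[OF subgroup_rot generate.incl[of "t \<otimes> r" "{t \<otimes> r}" G]] by simp
  then show "s \<in> carrier G \<and> (s \<in> rot \<or> s \<otimes> t \<in> rot)" if "s \<in> {t, r}" for s
    using that t r generate.one[of G] by auto
qed

text \<open>Such an \<open>s\<close> is a rotation times \<open>t\<close>, so it inverts rotations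
  because \<open>t\<close> does. That \<open>s\<close> squares to one is the case of the trivial
  rotation.\<close>

lemma reflection:
  assumes s: "s \<in> generate G {t, r}" "s \<notin> rot"
  shows "s \<otimes> s = \<one>" and "z \<in> rot \<Longrightarrow> s \<otimes> z \<otimes> s = inv z"
proof -
  note Rc = subgroup.mem_carrier[OF subgroup_rot]
  define y where "y = s \<otimes> t"
  have y: "y \<in> rot" using stabilizer_cosets[OF s(1)] s(2) by (auto simp: y_def)
  have sc: "s \<in> carrier G" using generate_in_carrier[of "{t, r}" s] s(1) t r by auto
  have sy: "s = y \<otimes> t" using sc t by (simp add: y_def m_assoc)
  have yc: "y \<in> carrier G" using Rc y by simp
  have conj: "y \<otimes> t \<otimes> z \<otimes> (y \<otimes> t) = y \<otimes> (t \<otimes> (z \<otimes> y) \<otimes> t)" if "z \<in> carrier G" for z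
    using that yc t by (simp add: m_assoc)
  have *: "s \<otimes> z \<otimes> s = inv z" if z: "z \<in> rot" for z
  proof -
    have "s \<otimes> z \<otimes> s = y \<otimes> inv (z \<otimes> y)"
      unfolding sy conj[OF Rc[OF z]]
      using conj_t_rot[OF subgroup.m_closed[OF subgroup_rot z y]] by simp
    then show ?thesis using Rc[OF z] yc by (simp add: inv_mult_group)
  qed
  show "z \<in> rot \<Longrightarrow> s \<otimes> z \<otimes> s = inv z" by (rule *)
  show "s \<otimes> s = \<one>" using *[OF generate.one] sc by simp
qed

end


section \<open>Reduced maps\<close>

lemma pi_number_2 [simp]: "pi_number \<pi> 2 \<longleftrightarrow> 2 \<in> \<pi>"
  by (simp add: pi_number_def prime_prime_factors)

lemma odd_of_pi_number_Compl:
  assumes "2 \<in> \<pi>" "pi_number (- \<pi>) n" "n > 0"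
  shows "odd n"
proof
  assume "even n"
  then have "pi_number (- \<pi>) 2" using assms pi_number_dvd by blast
  then show False using assms by simp
qed

lemma (in group) involution_eq_one:
  assumes "finite (carrier G)" "subgroup K G" "odd (card K)" "x \<in> K" "x \<otimes> x = \<one>"
  shows "x = \<one>"
proof -
  have xc: "x \<in> carrier G" using assms subgroup.mem_carrier by metis
  have "ord x dvd 2" using pow_eq_id[OF xc, of 2] xc assms by (simp add: numeral_2_eq_2)
  moreover have "ord x dvd card K" using ord_subgroup_dvd assms by metis
  moreover have "coprime 2 (card K)" using assms by simp
  ultimately have "ord x dvd 1" by (meson coprime_common_divisor)
  then show ?thesis using ord_eq_1[OF xc] by simp
qed

text \<open>The situation after dividing by the largest normal \<pi>-subgroup, with \<open>H\<close>
  the image of the vertex stabilizer. \<open>not_pi_compl\<close> records that the original group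
  has no normal Hall subgroup.\<close>

locale pi_reduced = finite_group +
  fixes \<pi> H
  assumes solvable: "solvable G"
    and reduced: "\<And>N. N \<lhd> G \<Longrightarrow> pi_number \<pi> (card N) \<Longrightarrow> N = {\<one>}"
    and not_pi_compl: "\<not> pi_number (- \<pi>) (order G)"
    and stabilizer: "subgroup H G"
    and index: "pi_number \<pi> (card (rcosets H))"
begin

abbreviation core :: "'a set" where
  "core \<equiv> O_pi (- \<pi>) G"

lemma core_normal: "core \<lhd> G" and core_pi: "pi_number (- \<pi>) (card core)"
  by (simp_all add: O_pi_normal O_pi_pi_number)

lemma subgroup_core: "subgroup core G"
  using core_normal by (rule normal_imp_subgroup)

lemma core_carrier: "k \<in> core \<Longrightarrow> k \<in> carrier G"
  using subgroup_core by (rule subgroup.mem_carrier)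

lemma card_core_pos: "card core > 0"
  using card_subgroup_pos[OF fin subgroup_core] .

lemma core_subset: "core \<subseteq> H"
  using normal_subset_of_pi_index[OF fin core_normal core_pi stabilizer index] .

lemma self_centralizing:
  assumes "c \<in> carrier G" "\<And>k. k \<in> core \<Longrightarrow> c \<otimes> k = k \<otimes> c"
  shows "c \<in> core"
  using centralizer_O_pi_compl_subset[OF solvable reduced] assms
  by (auto simp: centralizer_def)

lemma core_proper: "core \<noteq> carrier G"
  using core_pi not_pi_compl by (auto simp: order_def)

lemma core_nontrivial: "core \<noteq> {\<one>}"
proof
  assume *: "core = {\<one>}"
  then have "carrier G \<subseteq> core" using self_centralizing by auto
  then show False using core_proper core_carrier by blast
qed

text \<open>The element a commutes with its own powers, hence centralizes the core, and so belongs
  to it.\<close>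

lemma core_cyclic:
  assumes a: "a \<in> carrier G" and sub: "core \<subseteq> generate G {a}"
  shows "core = generate G {a}"
proof -
  have "a \<otimes> k = k \<otimes> a" if k: "k \<in> core" for k
  proof -
    obtain j :: int where "k = a [^] j" using subsetD[OF sub k] generate_pow[OF a] by auto
    then show ?thesis
      using a int_pow_mult[OF a, of 1 j] int_pow_mult[OF a, of j 1] by (simp add: add.commute)
  qed
  then have "a \<in> core" using self_centralizing[OF a] by blast
  then have "generate G {a} \<subseteq> core"
    using generate_subgroup_incl[OF _ subgroup_core] by simp
  with sub show ?thesis by blast
qed

lemma commute_with_generator:
  assumes a: "a \<in> carrier G" and K: "core = generate G {a}"
    and c: "c \<in> carrier G" "c \<otimes> a = a \<otimes> c"
  shows "c \<in> core"
proof (rule self_centralizing[OF c(1)])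
  fix k assume "k \<in> core"
  then obtain j :: int where k: "k = a [^] j" using K generate_pow[OF a] by auto
  have "c \<otimes> a \<otimes> inv c = a" using commute_iff_conj[OF c(1) a] c(2) by simp
  then have "c \<otimes> k \<otimes> inv c = k" unfolding k using conj_int_pow[OF c(1) a, of j] by simp
  then show "c \<otimes> k = k \<otimes> c" using commute_iff_conj[OF c(1)] a k by simp
qed

text \<open>If x and y commuted, y would centralize the core and lie in it, making the core the
  whole group. So \<open>is_D_I\<close> applies and the group has order 2 *
  \<open>card core\<close>. Since \<open>card core\<close> is a \<pi>'-number and the group order is
  not, 2 \<in> \<pi>.\<close>

lemma cyclic_stabilizer:
  assumes H: "H = generate G {x}" and x: "x \<in> carrier G" and y: "y \<in> carrier G" "y \<otimes> y = \<one>"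
    and gen: "generate G {x, y} = carrier G"
  shows "2 \<in> \<pi>"
    and "\<exists>m e. 3 \<le> m \<and> odd m \<and> [e ^ 2 = 1] (mod int m) \<and> \<not> [e = 1] (mod int m) \<and>
           is_D (ORMap G x y) m e"
proof -
  have K: "core = generate G {x}" using core_cyclic[OF x] core_subset H by simp
  have nc: "x \<otimes> y \<noteq> y \<otimes> x"
  proof
    assume "x \<otimes> y = y \<otimes> x"
    then have "y \<in> core" using commute_with_generator[OF x K y(1)] by simp
    moreover have "x \<in> core" using K generate.incl[of x "{x}" G] by simp
    ultimately have "generate G {x, y} \<subseteq> core"
      using generate_subgroup_incl[OF _ subgroup_core] by simp
    then show False using gen core_proper core_carrier by blast
  qed
  have norm: "generate G {x} \<lhd> G" using core_normal K by simp
  note D = is_D_I[OF x y norm gen nc]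
  have m: "ord x = card core" using generate_pow_card[OF x] K by simp
  show 2: "2 \<in> \<pi>"
    using not_pi_compl pi_number_mult[of "- \<pi>" 2 "ord x"] core_pi D(1) m by auto
  show "\<exists>m e. 3 \<le> m \<and> odd m \<and> [e ^ 2 = 1] (mod int m) \<and> \<not> [e = 1] (mod int m) \<and>
           is_D (ORMap G x y) m e"
    using D(2) odd_of_pi_number_Compl[OF 2 core_pi card_core_pos] m by simp
qed

end

locale pi_reduced_regular = pi_reduced + generated_by_involutions +
  assumes H_eq: "H = generate G {t, r}"
begin

section \<open>Regular maps with 2 \<in> \<pi>: the core is the rotation group of a vertex\<close>

context
  assumes two: "2 \<in> \<pi>"
begin

lemma odd_core: "odd (card core)"
  using odd_of_pi_number_Compl[OF two core_pi card_core_pos] .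

text \<open>Stabilizer elements outside \<open>rot\<close> square to one, and the core has odd
  order, so the core consists of rotations; \<open>core_cyclic\<close> then gives equality.\<close>

lemma core_rot: "core = rot"
proof (rule core_cyclic)
  show "t \<otimes> r \<in> carrier G" using t r by simp
  show "core \<subseteq> rot"
  proof
    fix k assume k: "k \<in> core"
    show "k \<in> rot"
    proof (rule ccontr)
      assume "k \<notin> rot"
      moreover have "k \<in> generate G {t, r}" using k core_subset H_eq by blast
      ultimately have "k \<otimes> k = \<one>" using reflection(1) by blast
      then have "k = \<one>" using involution_eq_one[OF fin subgroup_core odd_core k] by simp
      then show False using \<open>k \<notin> rot\<close> generate.one by metis
    qed
  qed
qed

text \<open>Odd order alone leaves the possibility t = 1. Then r = t r would lie in the core and be
  trivial as well, and so would the core.\<close>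

lemma t_notin_core: "t \<notin> core"
proof
  assume tK: "t \<in> core"
  have tr: "t \<otimes> r \<in> core" using core_rot generate.incl[of "t \<otimes> r" "{t \<otimes> r}" G] by simp
  have "t = \<one>" using involution_eq_one[OF fin subgroup_core odd_core tK] t by simp
  moreover from this have "r \<in> core" using tr r by simp
  then have "r = \<one>" using involution_eq_one[OF fin subgroup_core odd_core] r by simp
  ultimately have "core = {\<one>}" using core_rot generate_one by simp
  then show False using core_nontrivial by simp
qed

lemma rt_rot: "generate G {r \<otimes> t} \<subseteq> rot"
proof -
  have "r \<otimes> t = inv (t \<otimes> r)" using t r by (simp add: inv_mult_group)
  then have "r \<otimes> t \<in> rot"
    using subgroup.m_inv_closed[OF subgroup_rot generate.incl[of "t \<otimes> r" "{t \<otimes> r}" G]] by simp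
  then show ?thesis using generate_subgroup_incl[OF _ subgroup_rot] by simp
qed

lemma dihedral_quotient:
  assumes "generate G {t, r} = carrier G"
  obtains m h where "m \<ge> 1" "h \<in> iso G (dipole_group m (- 1))"
    "h t = dihedral_t" "h r = dihedral_r m" "h \<one> = \<one>\<^bsub>dipole_group m (- 1)\<^esub>"
  using dihedral_iso[OF t r assms] t_notin_core core_rot rt_rot by blast

lemma is_DM:
  assumes "l = \<one>"
  shows "\<exists>m\<ge>1. map_iso (RegMap G t r l) (DM m)"
proof -
  have "generate G {t, r, l} \<subseteq> generate G {t, r}"
    using assms generate_subgroup_incl[OF _ generate_is_subgroup[of "{t, r}"], of "{t, r, l}"] t r
    by (auto intro: generate.incl generate.one)
  then have "generate G {t, r} = carrier G" using gen generate_incl[of "{t, r}"] t r by auto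
  then show ?thesis
    by (rule dihedral_quotient) (use assms in \<open>auto simp: DM_def\<close>)
qed

lemma is_EM:
  assumes "l = t"
  shows "\<exists>m\<ge>1. map_iso (RegMap G t r l) (EM m)" and "even_part = core"
proof -
  have "{t, r, l} = {t, r}" using assms by auto
  then have "generate G {t, r} = carrier G" using gen by simp
  then show "\<exists>m\<ge>1. map_iso (RegMap G t r l) (EM m)"
    by (rule dihedral_quotient) (use assms in \<open>auto simp: EM_def\<close>)
  have "even_part \<subseteq> rot"
    using generate_subgroup_incl[OF _ subgroup_rot, of "{t \<otimes> r, r \<otimes> l}"] assms rt_rot
    by (auto intro: generate.incl)
  moreover have "rot \<subseteq> even_part" by (rule mono_generate) simp
  ultimately show "even_part = core" using core_rot by simp
qed

lemma tl_notin_core: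
  assumes "l \<noteq> t"
  shows "t \<otimes> l \<notin> core"
proof
  assume "t \<otimes> l \<in> core"
  then have "t \<otimes> l = \<one>" using involution_eq_one[OF fin subgroup_core odd_core] tl_square by simp
  then have "t \<otimes> (t \<otimes> l) = t" using t by simp
  then show False using assms t l by simp
qed

text \<open>Passes to the two generators that \<open>rotary_map\<close> uses.\<close>

lemma even_part_eq: "even_part = generate G {t \<otimes> r, t \<otimes> l}"
proof
  have sub: "subgroup (generate G {t \<otimes> r, t \<otimes> l}) G"
    by (rule generate_is_subgroup) (use t r l in auto)
  have "inv (t \<otimes> r) \<otimes> (t \<otimes> l) = r \<otimes> l" using t r l by (simp add: inv_mult_group m_assoc)
  moreover have "inv (t \<otimes> r) \<otimes> (t \<otimes> l) \<in> generate G {t \<otimes> r, t \<otimes> l}"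
    by (intro generate.eng generate.inv generate.incl) auto
  ultimately show "even_part \<subseteq> generate G {t \<otimes> r, t \<otimes> l}"
    by (intro generate_subgroup_incl[OF _ sub]) (auto intro: generate.incl)
  show "generate G {t \<otimes> r, t \<otimes> l} \<subseteq> even_part"
    by (intro generate_subgroup_incl[OF _ subgroup_even]) (auto intro: tr_even tl_even)
qed

text \<open>\<open>is_D_I\<close> is applied inside the even subgroup. If t r and t l commuted, t l
  would centralize the core, hence lie in it; having odd order and square one it would be trivial,
  giving l = t. The case l = 1, with half-turn t, is included.\<close>

lemma is_D_rotary:
  assumes "l \<noteq> t"
  shows "\<exists>m e. 3 \<le> m \<and> odd m \<and> [e ^ 2 = 1] (mod int m) \<and> \<not> [e = 1] (mod int m) \<and>
           is_D (rotary_map (RegMap G t r l)) m e"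
proof -
  let ?E = "G\<lparr>carrier := even_part\<rparr>"
  interpret E: finite_group ?E
    using subgroup_imp_group[OF subgroup_even] fin subgroup.subset[OF subgroup_even]
    by (simp add: finite_group_def finite_group_axioms_def finite_subset)
  have a: "t \<otimes> r \<in> carrier G" using t r by simp
  have g1: "generate ?E {t \<otimes> r} = core"
    using generate_consistent[OF _ subgroup_even, of "{t \<otimes> r}"] tr_even core_rot by simp
  have g2: "generate ?E {t \<otimes> r, t \<otimes> l} = carrier ?E"
    using generate_consistent[OF _ subgroup_even, of "{t \<otimes> r, t \<otimes> l}"] tr_even tl_even even_part_eq by simp
  have norm: "generate ?E {t \<otimes> r} \<lhd> ?E"
    unfolding g1
    by (rule normal_restrict_supergroup[OF subgroup_even core_normal])
      (use core_rot mono_generate[of "{t \<otimes> r}" "{t \<otimes> r, r \<otimes> l}"] in simp)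
  have nc: "t \<otimes> r \<otimes> (t \<otimes> l) \<noteq> t \<otimes> l \<otimes> (t \<otimes> r)"
  proof
    assume "t \<otimes> r \<otimes> (t \<otimes> l) = t \<otimes> l \<otimes> (t \<otimes> r)"
    then have "t \<otimes> l \<in> core" using commute_with_generator[OF a core_rot] t l by simp
    then show False using tl_notin_core[OF assms] by simp
  qed
  have "E.ord (t \<otimes> r) = card core" using E.generate_pow_card[of "t \<otimes> r"] tr_even g1 by simp
  then have "odd (E.ord (t \<otimes> r))" using odd_core by simp
  then show ?thesis
    using E.is_D_I(2)[of "t \<otimes> r" "t \<otimes> l", OF _ _ _ norm g2] nc tr_even tl_even tl_square
    by simp
qed

text \<open>For l = t the even part is the core. Otherwise it consists of the core and its coset by
  t l, so an even t would put t or t (t l) = l into the core, and an element squaring to one there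
  is trivial.\<close>

lemma t_notin_even:
  assumes "l \<noteq> \<one>"
  shows "t \<notin> even_part"
proof (cases "l = t")
  case True
  then show ?thesis using is_EM(2) t_notin_core by simp
next
  case False
  let ?s = "t \<otimes> l"
  have s: "?s \<in> carrier G" "?s \<otimes> ?s = \<one>" using t l tl_square by simp_all
  have tr_core: "t \<otimes> r \<in> core"
    using core_rot generate.incl[of "t \<otimes> r" "{t \<otimes> r}" G] by simp
  have inv_s: "inv ?s = ?s" using s by (rule involution_inv)
  show ?thesis
  proof
    assume "t \<in> even_part"
    then have "t \<in> generate G {t \<otimes> r, ?s}" using even_part_eq by simp
    then have "t \<in> core \<or> t \<otimes> ?s \<in> core"
    proof (rule generate_subset_two_cosets[OF subgroup_core s, rotated 2])
      show "?s \<otimes> a \<otimes> ?s \<in> core" if "a \<in> core" for a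
        using normal.inv_op_closed2[OF core_normal s(1) that] inv_s by simp
      show "u \<in> carrier G \<and> (u \<in> core \<or> u \<otimes> ?s \<in> core)" if "u \<in> {t \<otimes> r, ?s}" for u
        using that tr_core s subgroup.one_closed[OF subgroup_core] core_carrier by auto
    qed
    then have "l \<in> core" using t_notin_core t l by simp
    then show False using involution_eq_one[OF fin subgroup_core odd_core] l assms by simp
  qed
qed

end

end


section \<open>Maps with an odd number of vertices\<close>

text \<open>The generator is the least positive power of a lying in \<open>S\<close>; division with
  remainder does the rest.\<close>

lemma (in group) subgroup_of_cyclic:
  assumes fin: "finite (carrier G)" and a: "a \<in> carrier G"
    and S: "subgroup S G" "S \<subseteq> generate G {a}"
  obtains z where "z \<in> S" "S = generate G {z}"
proof -
  define P where "P n \<longleftrightarrow> n > 0 \<and> a [^] n \<in> S" for n :: nat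
  define n where "n = (LEAST n. P n)"
  have "P (ord a)"
    using ord_ge_1[OF fin a] a subgroup.one_closed[OF S(1)] by (simp add: P_def)
  then have n: "n > 0" "a [^] n \<in> S" using LeastI[of P] by (auto simp: P_def n_def)
  have least: "\<not> P k" if "k < n" for k using that not_less_Least unfolding n_def by blast
  have "S \<subseteq> generate G {a [^] n}"
  proof
    fix s assume s: "s \<in> S"
    then obtain k :: nat where k: "s = a [^] k"
      using S(2) generate_pow_on_finite_carrier[OF fin a] by auto
    let ?b = "(a [^] n) [^] (k div n)"
    have b: "?b \<in> generate G {a [^] n}"
      using generate_pow_on_finite_carrier[OF fin, of "a [^] n"] a by auto
    have bS: "?b \<in> S" using b generate_subgroup_incl[OF _ S(1), of "{a [^] n}"] n by auto
    have s_eq: "s = a [^] (k mod n) \<otimes> ?b"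
      using a by (simp add: k nat_pow_pow nat_pow_mult)
    then have "s \<otimes> inv ?b = a [^] (k mod n)" using a by (simp add: m_assoc)
    then have "a [^] (k mod n) \<in> S"
      using subgroup.m_closed[OF S(1) s subgroup.m_inv_closed[OF S(1) bS]] by simp
    then have "k mod n = 0" using least[of "k mod n"] n by (auto simp: P_def)
    then show "s \<in> generate G {a [^] n}" using s_eq b a by simp
  qed
  moreover have "generate G {a [^] n} \<subseteq> S" using generate_subgroup_incl[OF _ S(1)] n by simp
  ultimately show thesis using that n by blast
qed

text \<open>On \<open>A\<close> the map h factors through f. This will bound the number of cosets of
  the core by the number of ways of acting on it.\<close>

lemma card_image_le_factor:
  assumes "finite A" "\<And>a b. a \<in> A \<Longrightarrow> b \<in> A \<Longrightarrow> f a = f b \<Longrightarrow> h a = h b"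
  shows "card (h ` A) \<le> card (f ` A)"
proof -
  have "h a = h (inv_into A f (f a))" if "a \<in> A" for a
    using that assms(2)[of a "inv_into A f (f a)"] by (simp add: f_inv_into_f inv_into_into)
  then have "h ` A \<subseteq> (\<lambda>y. h (inv_into A f y)) ` f ` A" by auto
  then have "card (h ` A) \<le> card ((\<lambda>y. h (inv_into A f y)) ` f ` A)"
    using assms(1) by (intro card_mono) auto
  also have "\<dots> \<le> card (f ` A)" using assms(1) by (intro card_image_le) auto
  finally show ?thesis .
qed

text \<open>With \<open>ord g = 2 * i + 1\<close> the exponent is i + 1. Facts known for squares
  thereby reach all elements of odd order.\<close>

lemma (in group) odd_ord_pow_square:
  assumes g: "g \<in> carrier G" "odd (ord g)"
  obtains i where "g = (g \<otimes> g) [^] (i::nat)"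
proof -
  obtain i where i: "ord g = 2 * i + 1" using g(2) by (rule oddE)
  have "(g \<otimes> g) [^] (i + 1) = (g [^] (2::nat)) [^] (i + 1)" using g by (simp add: numeral_2_eq_2)
  also have "\<dots> = g [^] (2 * (i + 1))" using g(1) by (rule nat_pow_pow)
  also have "2 * (i + 1) = ord g + 1" using i by simp
  also have "g [^] (ord g + 1) = g" using g by simp
  finally show thesis using that[of "i + 1"] by simp
qed

text \<open>
  Each generator acts on a normal cyclic subgroup as a power map squaring to the identity, so the
  induced group of automorphisms has exponent two.
\<close>

lemma (in generated_by_involutions) odd_centralizes_cyclic:
  assumes Z: "generate G {z} \<lhd> G" and z: "z \<in> carrier G"
    and g: "g \<in> carrier G" "odd (ord g)" and k: "k \<in> generate G {z}"
  shows "g \<otimes> k = k \<otimes> g"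
proof -
  define P where "P g \<longleftrightarrow> (\<exists>e::int. g \<otimes> z \<otimes> inv g = z [^] e \<and> z [^] (e * e) = z)" for g
  have gens: "P u" if u: "u \<in> carrier G" "u \<otimes> u = \<one>" for u
  proof -
    have iu: "inv u = u" using u by (rule involution_inv)
    have "u \<otimes> z \<otimes> inv u \<in> generate G {z}"
      using normal.inv_op_closed2[OF Z u(1)] generate.incl[of z "{z}" G] by simp
    then obtain e :: int where e: "u \<otimes> z \<otimes> inv u = z [^] e" using generate_pow[OF z] by auto
    have "[e ^ 2 = 1] (mod int (ord z))" by (rule conj_square_cong[OF z u]) (use e iu in simp)
    then have "int (ord z) dvd 1 - e * e" by (metis cong_iff_dvd_diff cong_sym power2_eq_square)
    then have "z [^] (e * e) = z [^] (1::int)" using int_pow_eq[OF z] by blast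
    then show ?thesis using e z by (auto simp: P_def)
  qed
  have "g \<in> generate G {t, r, l}" using g gen by simp
  then have "P g"
  proof induction
    case one
    then show ?case using z by (auto simp: P_def intro!: exI[of _ "1::int"])
  next
    case (incl h)
    then show ?case using gens t r l by auto
  next
    case (inv h)
    then show ?case using gens t r l by auto
  next
    case (eng g h)
    have c: "g \<in> carrier G" "h \<in> carrier G" using eng(1,2) gen by auto
    obtain d :: int where d: "g \<otimes> z \<otimes> inv g = z [^] d" "z [^] (d * d) = z"
      using eng(3) by (auto simp: P_def)
    obtain e :: int where e: "h \<otimes> z \<otimes> inv h = z [^] e" "z [^] (e * e) = z"
      using eng(4) by (auto simp: P_def)
    have "(g \<otimes> h) \<otimes> z \<otimes> inv (g \<otimes> h) = g \<otimes> (h \<otimes> z \<otimes> inv h) \<otimes> inv g"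
      using c z by (simp add: inv_mult_group m_assoc)
    also have "\<dots> = (g \<otimes> z \<otimes> inv g) [^] e" unfolding e using conj_int_pow[OF c(1) z] by simp
    also have "\<dots> = z [^] (d * e)" unfolding d using z by (simp add: int_pow_pow)
    finally have "(g \<otimes> h) \<otimes> z \<otimes> inv (g \<otimes> h) = z [^] (d * e)" .
    moreover have "z [^] ((d * e) * (d * e)) = (z [^] (d * d)) [^] (e * e)"
      using z by (simp add: int_pow_pow mult_ac)
    ultimately show ?case unfolding P_def using d e by auto
  qed
  then obtain e :: int where e: "g \<otimes> z \<otimes> inv g = z [^] e" "z [^] (e * e) = z"
    by (auto simp: P_def)
  \<comment> \<open>The square of g centralizes z, and g, having odd order, is a power of its
    square.\<close>
  have "(g \<otimes> g) \<otimes> z \<otimes> inv (g \<otimes> g) = g \<otimes> (g \<otimes> z \<otimes> inv g) \<otimes> inv g"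
    using g z by (simp add: inv_mult_group m_assoc)
  also have "\<dots> = g \<otimes> z [^] e \<otimes> inv g" using e(1) by simp
  also have "\<dots> = (g \<otimes> z \<otimes> inv g) [^] e" using conj_int_pow[OF g(1) z] by simp
  also have "\<dots> = z" unfolding e(1) using z e(2) by (simp add: int_pow_pow)
  finally have "(g \<otimes> g) \<otimes> z = z \<otimes> (g \<otimes> g)"
    using commute_iff_conj[of "g \<otimes> g" z] g z by simp
  moreover obtain i where "g = (g \<otimes> g) [^] (i::nat)" using odd_ord_pow_square[OF g] .
  ultimately have "g \<otimes> z = z \<otimes> g"
    using group_commutes_pow[of "g \<otimes> g" z i] g z by simp
  then have "g \<otimes> z \<otimes> inv g = z" using commute_iff_conj[OF g(1) z] by simp
  moreover obtain j :: int where j: "k = z [^] j" using k generate_pow[OF z] by auto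
  ultimately have "g \<otimes> k \<otimes> inv g = k" using conj_int_pow[OF g(1) z, of j] by simp
  then show ?thesis using commute_iff_conj[OF g(1)] j z by simp
qed

context generated_by_involutions
begin

lemma reflection_mult:
  assumes "s \<in> generate G {t, r}" "s \<notin> rot" "s' \<in> generate G {t, r}" "s' \<notin> rot"
  shows "s \<otimes> s' \<in> rot"
proof -
  have c: "s \<in> carrier G" "s' \<in> carrier G" using assms generate_incl[of "{t, r}"] t r by auto
  have y: "s \<otimes> t \<in> rot" "s' \<otimes> t \<in> rot" using stabilizer_cosets assms by auto
  have "(s \<otimes> t) \<otimes> (t \<otimes> (s' \<otimes> t) \<otimes> t) \<in> rot"
    unfolding conj_t_rot[OF y(2)]
    using subgroup.m_closed[OF subgroup_rot y(1) subgroup.m_inv_closed[OF subgroup_rot y(2)]] .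
  then show ?thesis using c t by (simp add: m_assoc)
qed

text \<open>Write s = (t r)^k t. Half of the exponent can be carried past \<open>t\<close>, which
  inverts it, so s is a conjugate of t or of t r t according to the parity of k.\<close>

lemma reflection_conj:
  assumes s: "s \<in> generate G {t, r}" "s \<notin> rot"
  obtains g where "g \<in> rot" "s = g \<otimes> t \<otimes> inv g \<or> s = g \<otimes> (t \<otimes> r \<otimes> t) \<otimes> inv g"
proof -
  have a: "t \<otimes> r \<in> carrier G" using t r by simp
  have sc: "s \<in> carrier G" using s generate_incl[of "{t, r}"] t r by auto
  have "s \<otimes> t \<in> rot" using stabilizer_cosets s by auto
  then obtain k :: int where k: "s \<otimes> t = (t \<otimes> r) [^] k" using generate_pow[OF a] by auto
  define g where "g = (t \<otimes> r) [^] (k div 2)"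
  have g: "g \<in> rot" using generate_pow[OF a] by (auto simp: g_def)
  have gc: "g \<in> carrier G" using a by (simp add: g_def)
  have gt: "t \<otimes> inv g = g \<otimes> t"
  proof -
    have "t \<otimes> (t \<otimes> g \<otimes> t) = t \<otimes> inv g" using conj_t_rot[OF g] by simp
    then show ?thesis using gc t by (simp add: m_assoc)
  qed
  have k_eq: "k = k div 2 + k mod 2 + k div 2" by presburger
  have "(t \<otimes> r) [^] k = (t \<otimes> r) [^] (k div 2 + k mod 2 + k div 2)"
    by (rule arg_cong[OF k_eq])
  also have "\<dots> = g \<otimes> (t \<otimes> r) [^] (k mod 2) \<otimes> g"
    unfolding int_pow_mult[OF a] g_def ..
  finally have "s \<otimes> t \<otimes> t = g \<otimes> (t \<otimes> r) [^] (k mod 2) \<otimes> g \<otimes> t" using k by simp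
  then have "s = g \<otimes> (t \<otimes> r) [^] (k mod 2) \<otimes> g \<otimes> t" using sc t by (simp add: m_assoc)
  also have "\<dots> = g \<otimes> ((t \<otimes> r) [^] (k mod 2) \<otimes> t) \<otimes> inv g"
    using a gc t gt by (simp add: m_assoc)
  finally have s_eq: "s = g \<otimes> ((t \<otimes> r) [^] (k mod 2) \<otimes> t) \<otimes> inv g" .
  show thesis
  proof (cases "even k")
    case True
    then have "k mod 2 = 0" by simp
    then show thesis using that[OF g] s_eq t by simp
  next
    case False
    then have "k mod 2 = 1" by presburger
    then show thesis using that[OF g] s_eq a by simp
  qed
qed

lemma even_normal: "even_part \<lhd> G"
proof (rule normal_invI[OF subgroup_even])
  fix g e assume g: "g \<in> carrier G" and e: "e \<in> even_part"
  note m = subgroup.m_closed[OF subgroup_even] subgroup.m_inv_closed[OF subgroup_even]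
  have ec: "e \<in> carrier G" using e subgroup.mem_carrier[OF subgroup_even] by simp
  from even_cosets[OF g] show "g \<otimes> e \<otimes> inv g \<in> even_part"
  proof
    assume "g \<in> even_part"
    then show ?thesis using e m by simp
  next
    assume gt: "g \<otimes> t \<in> even_part"
    have "(g \<otimes> t) \<otimes> (t \<otimes> e \<otimes> t) \<otimes> inv (g \<otimes> t) = g \<otimes> e \<otimes> inv g"
      using g ec t by (simp add: m_assoc inv_mult_group)
    then show ?thesis using m(1)[OF m(1)[OF gt conj_t_even[OF e]] m(2)[OF gt]] by simp
  qed
qed

end

section \<open>The core when 2 \<notin> \<pi>\<close>

context pi_reduced_regular
begin

context
  assumes two: "2 \<notin> \<pi>"
begin

lemma obtain_pi_element:
  obtains p g where "prime p" "p \<in> \<pi>" "odd p" "p dvd order G" "g \<in> carrier G" "ord g = p"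
proof -
  have "\<exists>p. p \<in> prime_factors (order G) \<and> p \<in> \<pi>"
    using not_pi_compl by (auto simp: pi_number_def)
  then obtain p where p: "prime p" "p dvd order G" "p \<in> \<pi>" by (auto simp: in_prime_factors_iff)
  moreover obtain g where "g \<in> carrier G" "ord g = p"
    using cauchy[OF fin subgroup_self p(1)] p(2) by (auto simp: order_def)
  moreover have "odd p" using p two primes_dvd_imp_eq[of 2 p] by auto
  ultimately show thesis using that by blast
qed

lemma core_no_pi:
  assumes "prime p" "p \<in> \<pi>" "k \<in> core" "k [^] p = \<one>"
  shows "k = \<one>"
proof -
  have kc: "k \<in> carrier G" using assms core_carrier by simp
  have "pi_number \<pi> p" using assms by (simp add: pi_number_def prime_prime_factors)
  then have "coprime p (card core)"
    using pi_number_coprime[OF _ core_pi _ card_core_pos] assms(1) prime_gt_0_nat by blast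
  moreover have "ord k dvd p" using pow_eq_id[OF kc] assms by simp
  moreover have "ord k dvd card core" using ord_subgroup_dvd[OF fin subgroup_core assms(3)] .
  ultimately have "ord k dvd 1" by (meson coprime_common_divisor)
  then show ?thesis using ord_eq_1[OF kc] by simp
qed

lemma subgroup_core_rot: "subgroup (core \<inter> rot) G"
  using subgroups_Inter_pair[OF subgroup_core subgroup_rot] .

lemma core_stabilizer: "k \<in> core \<Longrightarrow> k \<in> generate G {t, r}"
  using core_subset H_eq by blast

lemma core_rot_cyclic:
  obtains z where "z \<in> core" "z \<in> rot" "core \<inter> rot = generate G {z}"
  using subgroup_of_cyclic[OF fin _ subgroup_core_rot, of "t \<otimes> r"] t r by auto

text \<open>Otherwise g of odd prime order p \<in> \<pi> centralizes the rotations in the core. It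
  sends a reflection s of the core to s w, with w a rotation in the core that g fixes, so g^n sends
  s to s w^n. For n = p this gives w^p = 1, hence w = 1 in a \<pi>'-group. Thus g centralizes the
  core and lies in it, which its order forbids.\<close>

lemma core_rot_not_normal: "\<not> core \<inter> rot \<lhd> G"
proof
  assume norm: "core \<inter> rot \<lhd> G"
  obtain z where z: "z \<in> core" "core \<inter> rot = generate G {z}" using core_rot_cyclic by blast
  obtain p g where p: "prime p" "p \<in> \<pi>" "odd p" and g: "g \<in> carrier G" "ord g = p"
    using obtain_pi_element by blast
  have centr: "g \<otimes> k = k \<otimes> g" if "k \<in> core \<inter> rot" for k
    using odd_centralizes_cyclic[of z g k] norm z core_carrier g p that by simp
  have "g \<otimes> s = s \<otimes> g" if s: "s \<in> core" for s
  proof (cases "s \<in> rot")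
    case True
    then show ?thesis using centr s by simp
  next
    case False
    have sc: "s \<in> carrier G" using s core_carrier by simp
    define s' where "s' = g \<otimes> s \<otimes> inv g"
    have s'K: "s' \<in> core" using normal.inv_op_closed2[OF core_normal g(1) s] by (simp add: s'_def)
    have s'c: "s' \<in> carrier G" using s'K core_carrier by simp
    have "s' \<notin> rot"
    proof
      assume "s' \<in> rot"
      then have "inv g \<otimes> s' \<otimes> g \<in> core \<inter> rot"
        using normal.inv_op_closed1[OF norm g(1)] s'K by blast
      moreover have "inv g \<otimes> s' \<otimes> g = s" using g sc by (simp add: s'_def m_assoc)
      ultimately show False using False by simp
    qed
    define w where "w = s \<otimes> s'"
    have w: "w \<in> core" "w \<in> rot"
      using reflection_mult[OF core_stabilizer[OF s] False core_stabilizer[OF s'K] \<open>s' \<notin> rot\<close>]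
        subgroup.m_closed[OF subgroup_core s s'K] by (simp_all add: w_def)
    have wc: "w \<in> carrier G" using w core_carrier by simp
    have ss: "s \<otimes> s = \<one>" using reflection(1)[OF core_stabilizer[OF s] False] .
    have s'w: "s' = s \<otimes> w" using sc s'c ss by (simp add: w_def flip: m_assoc)
    have gw: "g \<otimes> w \<otimes> inv g = w" using centr[of w] w commute_iff_conj[OF g(1) wc] by simp
    have "g [^] n \<otimes> s \<otimes> inv (g [^] n) = s \<otimes> w [^] n" for n :: nat
    proof (induction n)
      case (Suc n)
      have "g [^] Suc n \<otimes> s \<otimes> inv (g [^] Suc n) = g \<otimes> (g [^] n \<otimes> s \<otimes> inv (g [^] n)) \<otimes> inv g"
        unfolding nat_pow_Suc2[OF g(1)] using g sc by (simp add: inv_mult_group m_assoc)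
      also have "\<dots> = g \<otimes> (s \<otimes> w [^] n) \<otimes> inv g" using Suc by simp
      also have "\<dots> = (g \<otimes> s \<otimes> inv g) \<otimes> (g \<otimes> w \<otimes> inv g) [^] n"
        using conj_mult[OF g(1) sc, of "w [^] n"] conj_nat_pow[OF g(1) wc, of n] wc by simp
      also have "\<dots> = s \<otimes> w \<otimes> w [^] n" using s'w gw by (simp add: s'_def)
      also have "\<dots> = s \<otimes> w [^] Suc n" unfolding nat_pow_Suc2[OF wc] using sc wc by (simp add: m_assoc)
      finally show ?case .
    qed (use g sc in simp)
    from this[of p] have "s \<otimes> w [^] p = s" using g sc pow_ord_eq_1[OF g(1)] by simp
    then have "w [^] p = \<one>" using sc wc by simp
    then have "w = \<one>" using core_no_pi p w by blast
    then have "g \<otimes> s \<otimes> inv g = s" using s'w sc by (simp add: s'_def)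
    then show ?thesis using commute_iff_conj[OF g(1) sc] by simp
  qed
  then have "g \<in> core" using self_centralizing[OF g(1)] by blast
  then have "g = \<one>" using core_no_pi[OF p(1,2)] pow_ord_eq_1[OF g(1)] g(2) by simp
  then show False using g(2) p by auto
qed

text \<open>Some conjugation by x turns a rotation z of the core into a reflection s. For a rotation
  w of the core, its conjugate u commutes with s. If u is a reflection, its square is trivial; if u
  is a rotation, s also inverts it, so again its square is trivial. Hence w squares to one, the
  cyclic group \<open>core \<inter> rot\<close> has order 2, and the core is this group together
  with its coset by s.\<close>

lemma core_klein:
  obtains z s where "z \<in> rot" "s \<notin> rot" "z \<noteq> \<one>" "core = {\<one>, z, s, s \<otimes> z}"
    "z \<otimes> z = \<one>" "s \<otimes> s = \<one>" "z \<otimes> s = s \<otimes> z" "card core = 4"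
proof -
  obtain x z where x: "x \<in> carrier G"
    and z: "z \<in> core" "z \<in> rot" "x \<otimes> z \<otimes> inv x \<notin> core \<inter> rot"
    using core_rot_not_normal normal_invI[OF subgroup_core_rot] by blast
  have xK: "x \<otimes> k \<otimes> inv x \<in> core" if "k \<in> core" for k
    using normal.inv_op_closed2[OF core_normal x that] .
  define s where "s = x \<otimes> z \<otimes> inv x"
  have s: "s \<in> core" "s \<notin> rot" using z xK by (auto simp: s_def)
  note zc = core_carrier[OF z(1)] and sc = core_carrier[OF s(1)]
  note s_refl = reflection[OF core_stabilizer[OF s(1)] s(2)]
  have sq_conj: "w \<otimes> w = \<one>" if w: "w \<in> carrier G" "(x \<otimes> w \<otimes> inv x) \<otimes> (x \<otimes> w \<otimes> inv x) = \<one>" for w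
  proof -
    have "x \<otimes> (w \<otimes> w) \<otimes> inv x = \<one>" using conj_mult[OF x w(1) w(1)] w(2) by simp
    then have "x \<otimes> (w \<otimes> w) = x" using x w by (simp add: inv_solve_right')
    then show ?thesis using x w by simp
  qed
  have sq: "w \<otimes> w = \<one>" if w: "w \<in> core" "w \<in> rot" for w
  proof (rule sq_conj)
    show wc: "w \<in> carrier G" using core_carrier[OF w(1)] .
    define u where "u = x \<otimes> w \<otimes> inv x"
    have u: "u \<in> core" using xK[OF w(1)] by (simp add: u_def)
    note uc = core_carrier[OF u]
    \<comment> \<open>Both are conjugates by x of rotations, and rotations commute.\<close>
    have su: "s \<otimes> u = u \<otimes> s"
      unfolding s_def u_def using conj_mult[OF x zc wc] conj_mult[OF x wc zc] rot_commute[OF z(2) w(2)]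
      by simp
    have "u \<otimes> u = \<one>"
    proof (cases "u \<in> rot")
      case True
      have "s \<otimes> u \<otimes> s = u" using su uc sc s_refl(1) by (simp add: m_assoc)
      then have "u = inv u" using s_refl(2)[OF True] by simp
      then have "u \<otimes> u = u \<otimes> inv u" by simp
      then show ?thesis using uc by simp
    next
      case False
      then show ?thesis using reflection(1) core_stabilizer[OF u] by blast
    qed
    then show "(x \<otimes> w \<otimes> inv x) \<otimes> (x \<otimes> w \<otimes> inv x) = \<one>" by (simp add: u_def)
  qed
  have z1: "z \<noteq> \<one>"
  proof
    assume "z = \<one>"
    then have "s = \<one>" using x by (simp add: s_def)
    then show False using s(2) generate.one by metis
  qed
  obtain z0 where z0: "z0 \<in> core" "z0 \<in> rot" "core \<inter> rot = generate G {z0}"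
    using core_rot_cyclic by blast
  have pow: "z0 [^] (n::nat) \<in> {\<one>, z0}" for n
    using sq[OF z0(1,2)] core_carrier[OF z0(1)] by (induction n) auto
  have "core \<inter> rot \<subseteq> {\<one>, z0}"
    unfolding z0(3) generate_pow_on_finite_carrier[OF fin core_carrier[OF z0(1)]] using pow by blast
  then have Z: "core \<inter> rot \<subseteq> {\<one>, z}" using z z1 by blast
  have K: "core = {\<one>, z, s, s \<otimes> z}"
  proof
    show "core \<subseteq> {\<one>, z, s, s \<otimes> z}"
    proof
      fix k assume k: "k \<in> core"
      show "k \<in> {\<one>, z, s, s \<otimes> z}"
      proof (cases "k \<in> rot")
        case True
        then show ?thesis using k Z by blast
      next
        case False
        have "s \<otimes> k \<in> core \<inter> rot"
          using reflection_mult[OF core_stabilizer[OF s(1)] s(2) core_stabilizer[OF k] False]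
            subgroup.m_closed[OF subgroup_core s(1) k] by simp
        then have "s \<otimes> k = \<one> \<or> s \<otimes> k = z" using Z by blast
        moreover have "k = s \<otimes> (s \<otimes> k)" using sc core_carrier[OF k] s_refl(1) by (simp flip: m_assoc)
        ultimately show ?thesis using sc by auto
      qed
    qed
    show "{\<one>, z, s, s \<otimes> z} \<subseteq> core"
      using z s subgroup.one_closed[OF subgroup_core] subgroup.m_closed[OF subgroup_core] by simp
  qed
  have zz: "z \<otimes> z = \<one>" using sq z by blast
  have zs: "z \<otimes> s = s \<otimes> z"
  proof -
    have "s \<otimes> z \<otimes> s = z" using s_refl(2)[OF z(2)] zz zc involution_inv by simp
    then have "s \<otimes> (s \<otimes> z \<otimes> s) = s \<otimes> z" by simp
    then show ?thesis using sc zc s_refl(1) by (simp flip: m_assoc)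
  qed
  have "s \<otimes> z \<notin> rot"
  proof
    assume "s \<otimes> z \<in> rot"
    then have "s \<otimes> z \<otimes> z \<in> rot" using subgroup.m_closed[OF subgroup_rot] z by blast
    then show False using s zz sc zc by (simp add: m_assoc)
  qed
  then have "card {\<one>, z, s, s \<otimes> z} = 4"
  proof -
    have "\<one> \<in> rot" by (rule generate.one)
    then have "s \<noteq> \<one>" "s \<noteq> z" "s \<otimes> z \<noteq> \<one>" "s \<otimes> z \<noteq> z" using s z \<open>s \<otimes> z \<notin> rot\<close> by metis+
    moreover have "s \<otimes> z \<noteq> s" using z1 sc zc by simp
    ultimately show ?thesis using z1 by (simp add: eq_commute)
  qed
  then have "card core = 4" using K by simp
  then show thesis using that[OF z(2) s(2) z1 K zz s_refl(1) zs] by blast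
qed

end

end


section \<open>The doubled triangle\<close>

text \<open>In a triangle an edge is determined, up to its parallel, by the vertex it misses. So any
  numbering of the vertices will do, and the two edges missing a given vertex are told apart by an
  arbitrary bijection with the booleans.\<close>

lemma doubled_3_cycleI:
  fixes I :: "'v \<Rightarrow> 'd \<Rightarrow> bool"
  assumes V: "card V = 3" and D: "card D = 6"
    and miss: "\<And>d. d \<in> D \<Longrightarrow> card {v \<in> V. \<not> I v d} = 1"
    and missed: "\<And>v. v \<in> V \<Longrightarrow> card {d \<in> D. \<not> I v d} = 2"
  shows "\<exists>f g. bij_betw f V {0..<3 :: nat} \<and> bij_betw g D ({0..<3 :: nat} \<times> (UNIV :: bool set)) \<and>
           (\<forall>v \<in> V. \<forall>d \<in> D. I v d \<longleftrightarrow> f v \<in> {fst (g d), (fst (g d) + 1) mod 3})"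
proof -
  have fin: "finite V" "finite D" using V D by (auto intro: card_ge_0_finite)
  define m where "m d = (THE v. v \<in> V \<and> \<not> I v d)" for d
  have m: "v \<in> V \<and> \<not> I v d \<longleftrightarrow> v = m d" if d: "d \<in> D" for v d
  proof -
    obtain u where u: "{v \<in> V. \<not> I v d} = {u}" using miss[OF d] by (auto simp: card_1_singleton_iff)
    then have "m d = u" unfolding m_def by (intro the_equality) auto
    then show ?thesis using u by auto
  qed
  obtain f where f: "bij_betw f V {0..<3 :: nat}"
    using finite_same_card_bij[of V "{0..<3 :: nat}"] fin V by auto
  have "\<exists>b. bij_betw b {d \<in> D. \<not> I v d} (UNIV :: bool set)" if "v \<in> V" for v
    using finite_same_card_bij[of "{d \<in> D. \<not> I v d}" "UNIV :: bool set"] fin missed[OF that] by simp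
  then obtain b where b: "\<And>v. v \<in> V \<Longrightarrow> bij_betw (b v) {d \<in> D. \<not> I v d} (UNIV :: bool set)" by metis
  \<comment> \<open>The edge (i, b) joins i and i + 1, so it misses i + 2; missing the vertex a
    therefore means i = a + 1 modulo 3.\<close>
  define g where "g d = ((f (m d) + 1) mod 3, b (m d) d)" for d
  have mV: "m d \<in> V" "\<not> I (m d) d" if "d \<in> D" for d using m[OF that] by auto
  have f3: "f v < 3" if "v \<in> V" for v using f that by (auto simp: bij_betw_def)
  have shift: "x = y" if "(x + 1) mod 3 = (y + 1) mod 3" "x < 3" "y < 3" for x y :: nat
  proof -
    have "x \<in> {0, 1, 2}" "y \<in> {0, 1, 2}" using that by auto
    then show ?thesis using that(1) by auto
  qed
  have "inj_on g D"
  proof (rule inj_onI)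
    fix d d' assume d: "d \<in> D" "d' \<in> D" "g d = g d'"
    then have "f (m d) = f (m d')"
      using shift[OF _ f3[OF mV(1)[OF d(1)]] f3[OF mV(1)[OF d(2)]]] d(3) by (simp add: g_def)
    then have mm: "m d = m d'"
      using inj_onD[OF bij_betw_imp_inj_on[OF f]] mV(1) d by simp
    moreover have "inj_on (b (m d)) {e \<in> D. \<not> I (m d) e}"
      using b[OF mV(1)[OF d(1)]] by (simp add: bij_betw_def)
    ultimately show "d = d'"
      using inj_onD[of "b (m d)" "{e \<in> D. \<not> I (m d) e}" d d'] d mV(2)[of d] mV(2)[of d'] by (simp add: g_def)
  qed
  moreover have "g ` D = {0..<3} \<times> UNIV"
  proof (rule card_subset_eq)
    show "card (g ` D) = card ({0..<3 :: nat} \<times> (UNIV :: bool set))"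
      using card_image[OF \<open>inj_on g D\<close>] D by (simp add: card_cartesian_product)
  qed (auto simp: g_def)
  ultimately have "bij_betw g D ({0..<3} \<times> UNIV)" by (simp add: bij_betw_def)
  moreover have "I v d \<longleftrightarrow> f v \<in> {fst (g d), (fst (g d) + 1) mod 3}" if v: "v \<in> V" and d: "d \<in> D" for v d
  proof -
    have "I v d \<longleftrightarrow> v \<noteq> m d" using m[OF d] v by auto
    also have "\<dots> \<longleftrightarrow> f v \<noteq> f (m d)"
      using inj_on_eq_iff[OF bij_betw_imp_inj_on[OF f] v mV(1)[OF d]] by simp
    also have "\<dots> \<longleftrightarrow> f v \<in> {fst (g d), (fst (g d) + 1) mod 3}"
    proof -
      have "f v \<in> {0, 1, 2}" "f (m d) \<in> {0, 1, 2}" using f3[OF v] f3[OF mV(1)[OF d]] by auto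
      then show ?thesis by (auto simp: g_def)
    qed
    finally show ?thesis .
  qed
  ultimately show ?thesis using f by blast
qed

context group
begin

lemma r_coset_inj:
  assumes "A \<subseteq> carrier G" "B \<subseteq> carrier G" "g \<in> carrier G" "A #> g = B #> g"
  shows "A = B"
proof -
  have "X #> g #> inv g = X" if "X \<subseteq> carrier G" for X
    using that assms(3) by (simp add: coset_mult_assoc)
  then show ?thesis using assms by metis
qed

lemma r_coset_disjoint:
  assumes "A \<subseteq> carrier G" "B \<subseteq> carrier G" "g \<in> carrier G" "A \<inter> B = {}"
  shows "(A #> g) \<inter> (B #> g) = {}"
  using assms by (auto simp: r_coset_def subset_iff disjoint_iff)

text \<open>Right translation permutes both families of cosets and is transitive on each.\<close>

lemma card_disjoint_rcosets_le:
  assumes fin: "finite (carrier G)" and H: "subgroup H G" and L: "subgroup L G"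
    and v: "v \<in> rcosets H" and w: "w \<in> rcosets H"
  shows "card {d \<in> rcosets L. v \<inter> d = {}} \<le> card {d \<in> rcosets L. w \<inter> d = {}}"
proof -
  obtain x y where x: "x \<in> carrier G" "v = H #> x" and y: "y \<in> carrier G" "w = H #> y"
    using v w by (auto simp: RCOSETS_def)
  define g where "g = inv x \<otimes> y"
  have g: "g \<in> carrier G" using x y by (simp add: g_def)
  have sub: "d \<subseteq> carrier G" if "d \<in> rcosets L" for d using rcosets_subset_PowG[OF L] that by blast
  have subv: "v \<subseteq> carrier G" using rcosets_subset_PowG[OF H] v by blast
  have vg: "v #> g = w"
    using x y subgroup.subset[OF H] by (simp add: g_def coset_mult_assoc flip: m_assoc)
  have "inj_on (\<lambda>d. d #> g) {d \<in> rcosets L. v \<inter> d = {}}"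
    using r_coset_inj[OF sub sub g] by (auto simp: inj_on_def)
  moreover have "(\<lambda>d. d #> g) ` {d \<in> rcosets L. v \<inter> d = {}} \<subseteq> {d \<in> rcosets L. w \<inter> d = {}}"
  proof clarify
    fix d assume d: "d \<in> rcosets L" "v \<inter> d = {}"
    then obtain u where u: "u \<in> carrier G" "d = L #> u" by (auto simp: RCOSETS_def)
    then have "d #> g = L #> (u \<otimes> g)" using g subgroup.subset[OF L] by (simp add: coset_mult_assoc)
    then have "d #> g \<in> rcosets L" using u g by (auto simp: RCOSETS_def)
    then show "d #> g \<in> rcosets L \<and> w \<inter> (d #> g) = {}"
      using r_coset_disjoint[OF subv sub[OF d(1)] g d(2)] vg by simp
  qed
  moreover have "finite {d \<in> rcosets L. w \<inter> d = {}}"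
    using finite_subset[OF rcosets_subset_PowG[OF L]] fin by simp
  ultimately show ?thesis by (rule card_inj_on_le)
qed

end

section \<open>The reduced map with 2 \<notin> \<pi> is the doubled triangle\<close>

context pi_reduced_regular
begin

context
  assumes two: "2 \<notin> \<pi>" and nontrivial: "t \<noteq> \<one>" "r \<noteq> \<one>" "l \<noteq> \<one>"
begin

text \<open>
  Conjugation embeds \<open>G / core\<close> into the permutations of the three involutions of the four-group
  \<open>core\<close>. The index is divisible by a prime of \<open>\<pi>\<close>, hence by an odd prime, and it is even because
  one of the generating involutions lies outside \<open>core\<close>; so all six permutations occur.
\<close>

lemma order_and_transitivity:
  shows "order G = 24" and "3 \<in> \<pi>" and "card core = 4"
    and "\<And>u v. u \<in> core \<Longrightarrow> v \<in> core \<Longrightarrow> u \<noteq> \<one> \<Longrightarrow> v \<noteq> \<one> \<Longrightarrow>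
           \<exists>g\<in>carrier G. g \<otimes> u \<otimes> inv g = v"
proof -
  obtain z s where K: "core = {\<one>, z, s, s \<otimes> z}" "z \<noteq> \<one>" and card_core: "card core = 4"
    using core_klein[OF two] by metis
  have zK: "z \<in> core" and sK: "s \<in> core" using K by auto
  note zc = core_carrier[OF zK] and sc = core_carrier[OF sK]
  have dist: "s \<noteq> \<one>" "z \<noteq> s" "s \<otimes> z \<noteq> \<one>" "s \<otimes> z \<noteq> z" "s \<otimes> z \<noteq> s"
  proof -
    have "distinct [\<one>, z, s, s \<otimes> z]" by (rule card_distinct) (use K card_core in simp)
    then show "s \<noteq> \<one>" "z \<noteq> s" "s \<otimes> z \<noteq> \<one>" "s \<otimes> z \<noteq> z" "s \<otimes> z \<noteq> s" by auto
  qed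
  \<comment> \<open>The action on the four-group is determined by the images of z and s;
    \<open>W\<close> lists the six ordered pairs of distinct involutions.\<close>
  define F where "F g = (g \<otimes> z \<otimes> inv g, g \<otimes> s \<otimes> inv g)" for g
  define W where "W = {(z, s), (z, s \<otimes> z), (s, z), (s, s \<otimes> z), (s \<otimes> z, z), (s \<otimes> z, s)}"
  have conj1: "g \<otimes> u \<otimes> inv g \<noteq> \<one>" if "g \<in> carrier G" "u \<in> carrier G" "u \<noteq> \<one>" for g u
  proof
    assume "g \<otimes> u \<otimes> inv g = \<one>"
    then have "g \<otimes> u = g" using that inv_solve_right'[of \<one> "g \<otimes> u" g] by simp
    then show False using that by simp
  qed
  have FW: "F ` carrier G \<subseteq> W"
  proof (rule image_subsetI)
    fix g assume g: "g \<in> carrier G"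
    have "g \<otimes> z \<otimes> inv g \<in> core" "g \<otimes> s \<otimes> inv g \<in> core"
      using normal.inv_op_closed2[OF core_normal g] zK sK by auto
    moreover have "g \<otimes> z \<otimes> inv g \<noteq> \<one>" "g \<otimes> s \<otimes> inv g \<noteq> \<one>" using conj1 g zc sc K dist by auto
    moreover have "g \<otimes> z \<otimes> inv g \<noteq> g \<otimes> s \<otimes> inv g" using g zc sc dist by simp
    ultimately show "F g \<in> W" unfolding K(1) by (auto simp: F_def W_def)
  qed
  have cW: "card W = 6" using dist by (auto simp: W_def)
  have finW: "finite W" by (simp add: W_def)
  have coset: "core #> g = core #> h" if g: "g \<in> carrier G" and h: "h \<in> carrier G" and F: "F g = F h" for g h
  proof -
    let ?d = "inv h \<otimes> g"
    have d: "?d \<in> carrier G" using g h by simp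
    have fixed: "?d \<otimes> u \<otimes> inv ?d = u" if "u \<in> carrier G" "g \<otimes> u \<otimes> inv g = h \<otimes> u \<otimes> inv h" for u
    proof -
      have "?d \<otimes> u \<otimes> inv ?d = inv h \<otimes> (g \<otimes> u \<otimes> inv g) \<otimes> h"
        using g h that(1) by (simp add: inv_mult_group m_assoc)
      also have "\<dots> = u" unfolding that(2) using h that(1) by (simp add: m_assoc)
      finally show ?thesis .
    qed
    have dz: "?d \<otimes> z \<otimes> inv ?d = z" and ds: "?d \<otimes> s \<otimes> inv ?d = s"
      using fixed[OF zc] fixed[OF sc] F by (simp_all add: F_def)
    have dsz: "?d \<otimes> (s \<otimes> z) \<otimes> inv ?d = s \<otimes> z"
      unfolding conj_mult[OF d sc zc] dz ds ..
    have "?d \<in> core"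
    proof (rule self_centralizing[OF d])
      fix k assume "k \<in> core"
      then have "k \<in> carrier G" "?d \<otimes> k \<otimes> inv ?d = k"
        using K(1) dz ds dsz zc sc d by auto
      then show "?d \<otimes> k = k \<otimes> ?d" using commute_iff_conj[OF d] by simp
    qed
    then have "h \<otimes> ?d \<otimes> inv h \<in> core" using normal.inv_op_closed2[OF core_normal h] by blast
    moreover have "h \<otimes> ?d \<otimes> inv h = g \<otimes> inv h" using g h by (simp flip: m_assoc)
    ultimately have "g \<otimes> inv h \<in> core" by simp
    then have "core #> (g \<otimes> inv h) = core"
      using coset_join2[OF _ subgroup_core] core_carrier by simp
    then have "core #> (g \<otimes> inv h) #> h = core #> h" by simp
    then show ?thesis
      using g h subgroup.subset[OF subgroup_core] by (simp add: coset_mult_assoc m_assoc)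
  qed
  define j where "j = card (rcosets core)"
  have "rcosets core = (\<lambda>g. core #> g) ` carrier G" by (auto simp: RCOSETS_def)
  moreover have "card ((\<lambda>g. core #> g) ` carrier G) \<le> card (F ` carrier G)"
    by (rule card_image_le_factor[OF fin coset])
  ultimately have jF: "j \<le> card (F ` carrier G)" by (simp add: j_def)
  have FW6: "card (F ` carrier G) \<le> 6" using card_mono[OF finW FW] cW by simp
  have order: "order G = j * 4" using lagrange_finite[OF fin subgroup_core] card_core by (simp add: j_def)
  obtain p where p: "prime p" "p \<in> \<pi>" "odd p" "p dvd order G"
    by (rule obtain_pi_element[OF two])
  have "coprime p 2" using p(3) by simp
  then have "coprime p 4" using coprime_mult_right_iff[of p 2 2] by simp
  then have pj: "p dvd j" using p(4) order by (simp add: coprime_dvd_mult_left_iff)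
  obtain u where u: "u \<in> {t, r, l}" "u \<notin> core"
  proof -
    have "\<not> {t, r, l} \<subseteq> core"
      using generate_subgroup_incl[OF _ subgroup_core, of "{t, r, l}"] gen core_proper core_carrier by blast
    then show ?thesis using that by blast
  qed
  have uc: "u \<in> carrier G" "u \<otimes> u = \<one>" using u t r l by auto
  have sub_u: "subgroup {\<one>, u} G"
    by (rule subgroupI) (use uc involution_inv[OF uc] in auto)
  have "u \<noteq> \<one>" using u subgroup.one_closed[OF subgroup_core] by auto
  then have "card {\<one>, u} = 2" by auto
  moreover have "core \<inter> {\<one>, u} = {\<one>}" using u subgroup.one_closed[OF subgroup_core] by auto
  \<comment> \<open>A subgroup of order 8 makes 4 j divisible by 8, so \<open>j\<close> is
    even.\<close>
  ultimately have c8: "card (core <#> {\<one>, u}) = 8"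
    using card_set_mult[OF core_normal sub_u] card_core by simp
  have "second_isomorphism_grp core G {\<one>, u}"
    using core_normal sub_u by (simp add: second_isomorphism_grp_def second_isomorphism_grp_axioms_def)
  then have "subgroup (core <#> {\<one>, u}) G" by (rule second_isomorphism_grp.normal_set_mult_subgroup)
  then have "8 dvd order G" using card_subgroup_dvd[OF fin] c8 by metis
  then have "even j" using order by presburger
  then have "2 * p dvd j" using pj \<open>coprime p 2\<close> by (simp add: divides_mult mult.commute coprime_commute)
  moreover have "j \<le> 6" using jF FW6 by simp
  moreover have "j > 0" using order fin order_gt_0_iff_finite by (metis mult_0 neq0_conv)
  ultimately have "2 * p \<le> 6" using dvd_imp_le by (meson le_trans)
  moreover have "p \<ge> 2" using p(1) by (rule prime_ge_2_nat)
  ultimately have p3: "p = 3" using p(3) by (cases "p = 2") auto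
  then have j6: "j = 6" using \<open>2 * p dvd j\<close> \<open>j \<le> 6\<close> \<open>j > 0\<close> by (auto dest: dvd_imp_le)
  show "order G = 24" using order j6 by simp
  show "3 \<in> \<pi>" using p p3 by simp
  show "card core = 4" by (rule card_core)
  have FW_eq: "F ` carrier G = W"
    by (rule card_subset_eq[OF finW FW]) (use jF j6 FW6 cW in simp)
  have from_z: "\<exists>g\<in>carrier G. g \<otimes> z \<otimes> inv g = v" if v: "v \<in> core" "v \<noteq> \<one>" for v
  proof -
    have "\<exists>w. (v, w) \<in> W" using v K(1) by (auto simp: W_def)
    then obtain w where "(v, w) \<in> F ` carrier G" using FW_eq by blast
    then show ?thesis by (auto simp: F_def)
  qed
  show "\<exists>g\<in>carrier G. g \<otimes> u \<otimes> inv g = v" if uv: "u \<in> core" "v \<in> core" "u \<noteq> \<one>" "v \<noteq> \<one>" for u v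
  proof -
    obtain g where g: "g \<in> carrier G" "g \<otimes> z \<otimes> inv g = u" using from_z uv by blast
    obtain h where h: "h \<in> carrier G" "h \<otimes> z \<otimes> inv h = v" using from_z uv by blast
    have "(h \<otimes> inv g) \<otimes> u \<otimes> inv (h \<otimes> inv g) = h \<otimes> z \<otimes> inv h"
      unfolding g(2)[symmetric] using g(1) h(1) zc by (simp add: inv_mult_group m_assoc)
    then show ?thesis using g h by (metis inv_closed m_closed)
  qed
qed

text \<open>Suppose t is odd. Of the involutions z, s, s z at least one is even, as a product of two
  odd elements is even. The even part is normal and the involutions of the core are conjugate, so
  the whole core is even. But the core contains a reflection, hence by conjugation t or t r t, and
  in either case t is even.\<close>

lemma t_even: "t \<in> even_part"
proof (rule ccontr)
  assume nt: "t \<notin> even_part"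
  obtain z s where K: "core = {\<one>, z, s, s \<otimes> z}" "z \<noteq> \<one>" and s_rot: "s \<notin> rot" and sz: "s \<otimes> s = \<one>"
    and card4: "card core = 4"
    using core_klein[OF two] by metis
  have zK: "z \<in> core" and sK: "s \<in> core" and szK: "s \<otimes> z \<in> core" using K by auto
  note zc = core_carrier[OF zK] and sc = core_carrier[OF sK]
  have s1: "s \<noteq> \<one>" using s_rot generate.one by metis
  have sz1: "s \<otimes> z \<noteq> \<one>"
  proof
    assume "s \<otimes> z = \<one>"
    then have "s \<otimes> z = s \<otimes> s" using sz by simp
    then have "z = s" using zc sc by simp
    then have "core \<subseteq> {\<one>, s}" using K sz by auto
    then show False using card4 card_mono[of "{\<one>, s}" core] card_insert_le_m1[of 2 "{s}" \<one>] by auto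
  qed
  have "\<exists>u\<in>core. u \<noteq> \<one> \<and> u \<in> even_part"
    using mult_odd_even[OF sc zc] zK sK szK K(2) s1 sz1 by metis
  then obtain u where u: "u \<in> core" "u \<noteq> \<one>" "u \<in> even_part" by blast
  have core_even: "v \<in> even_part" if v: "v \<in> core" for v
  proof (cases "v = \<one>")
    case True
    then show ?thesis using generate.one by metis
  next
    case False
    then obtain g where "g \<in> carrier G" "g \<otimes> u \<otimes> inv g = v"
      using order_and_transitivity(4)[OF u(1) v u(2)] by blast
    then show ?thesis using normal.inv_op_closed2[OF even_normal _ u(3)] by metis
  qed
  obtain g where g: "g \<in> rot" "s = g \<otimes> t \<otimes> inv g \<or> s = g \<otimes> (t \<otimes> r \<otimes> t) \<otimes> inv g"
    using reflection_conj[OF core_stabilizer[OF two sK] s_rot] by blast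
  have gc: "g \<in> carrier G" using g subgroup.mem_carrier[OF subgroup_rot] by simp
  have "inv g \<otimes> s \<otimes> g \<in> core" using normal.inv_op_closed1[OF core_normal gc sK] .
  moreover have "inv g \<otimes> (g \<otimes> x \<otimes> inv g) \<otimes> g = x" if "x \<in> carrier G" for x
    using that gc by (simp add: m_assoc)
  ultimately have "t \<in> core \<or> t \<otimes> r \<otimes> t \<in> core" using g t r by (metis m_closed)
  then show False
  proof
    assume "t \<in> core"
    then show False using core_even nt by blast
  next
    assume "t \<otimes> r \<otimes> t \<in> core"
    then have "inv (t \<otimes> r) \<otimes> (t \<otimes> r \<otimes> t) \<in> even_part"
      using core_even generate.eng subgroup.m_inv_closed[OF subgroup_even tr_even] by metis
    moreover have "inv (t \<otimes> r) \<otimes> (t \<otimes> r \<otimes> t) = t" using t r by (simp add: inv_mult_group m_assoc)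
    ultimately show False using nt by simp
  qed
qed

text \<open>Inside the stabilizer, rotations centralize \<open>core \<inter> rot\<close> and
  reflections invert it. So it would be normal, against \<open>core_rot_not_normal\<close>.\<close>

lemma stabilizer_proper: "generate G {t, r} \<noteq> carrier G"
proof
  assume *: "generate G {t, r} = carrier G"
  have "core \<inter> rot \<lhd> G"
  proof (rule normal_invI[OF subgroup_core_rot[OF two]])
    fix h w assume h: "h \<in> carrier G" and w: "w \<in> core \<inter> rot"
    have wc: "w \<in> carrier G" using w core_carrier by blast
    have "h \<otimes> w \<otimes> inv h \<in> rot"
    proof (cases "h \<in> rot")
      case True
      then have "h \<otimes> w \<otimes> inv h = w" using rot_commute[of h w] w commute_iff_conj[OF h wc] by simp
      then show ?thesis using w by simp
    next
      case False
      have hs: "h \<in> generate G {t, r}" using h * by simp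
      have "inv h = h" using involution_inv[OF h reflection(1)[OF hs False]] .
      then have "h \<otimes> w \<otimes> inv h = inv w" using reflection(2)[OF hs False] w by simp
      then show ?thesis using subgroup.m_inv_closed[OF subgroup_rot] w by simp
    qed
    then show "h \<otimes> w \<otimes> inv h \<in> core \<inter> rot"
      using normal.inv_op_closed2[OF core_normal h] w by blast
  qed
  then show False using core_rot_not_normal[OF two] by simp
qed

lemma l_notin_stabilizer: "l \<notin> generate G {t, r}"
proof
  assume "l \<in> generate G {t, r}"
  then have "generate G {t, r, l} \<subseteq> generate G {t, r}"
    using t r by (intro generate_subgroup_incl generate_is_subgroup) (auto intro: generate.incl)
  then show False using stabilizer_proper gen generate_incl[of "{t, r}"] t r by auto
qed

text \<open>The index divides 24 = 3 * 8, is odd because it is a \<pi>-number and 2 \<notin> \<pi>,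
  and exceeds 1 because the stabilizer is proper.\<close>

lemma card_vertices: "card (rcosets (generate G {t, r})) = 3"
proof -
  let ?j = "card (rcosets (generate G {t, r}))"
  have sub: "subgroup (generate G {t, r}) G" by (rule generate_is_subgroup) (use t r in auto)
  have order: "?j * card (generate G {t, r}) = 24"
    using lagrange_finite[OF fin sub] order_and_transitivity(1) by simp
  have "odd ?j"
  proof
    assume "even ?j"
    moreover have "?j \<noteq> 0" using order by (intro notI) simp
    ultimately have "pi_number \<pi> 2" using pi_number_dvd[of \<pi> ?j 2] index H_eq by simp
    then show False using two by simp
  qed
  then have "coprime ?j (2 ^ 3)" by (metis coprime_power_right_iff coprime_right_2_iff_odd)
  moreover have "?j dvd 24" using order by (metis dvd_triv_left)
  then have "?j dvd 3 * 2 ^ 3" by simp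
  ultimately have "?j dvd 3" using coprime_dvd_mult_left_iff by blast
  moreover have "prime (3::nat)" by simp
  ultimately have "?j = 1 \<or> ?j = 3" using prime_nat_iff by blast
  moreover have "?j \<noteq> 1"
  proof
    assume "?j = 1"
    then have "card (generate G {t, r}) = card (carrier G)"
      using order order_and_transitivity(1) by (simp add: order_def)
    then have "generate G {t, r} = carrier G"
      using card_subset_eq[OF fin subgroup.subset[OF sub]] by simp
    then show False using stabilizer_proper by simp
  qed
  ultimately show ?thesis by simp
qed

lemma edge_stabilizer: "generate G {t, l} = {\<one>, t, l, t \<otimes> l}"
proof
  have ltz: "l \<otimes> (t \<otimes> z) = t \<otimes> (l \<otimes> z)" if "z \<in> carrier G" for z
    using that t l tl by (metis m_assoc)
  have tl_inv: "inv (t \<otimes> l) = t \<otimes> l" using t l tl by (simp add: inv_mult_group)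
  have "subgroup {\<one>, t, l, t \<otimes> l} G"
    by (rule subgroupI) (use t l tl[symmetric] ltz tl_inv in \<open>auto simp: m_assoc\<close>)
  then show "generate G {t, l} \<subseteq> {\<one>, t, l, t \<otimes> l}" by (intro generate_subgroup_incl) auto
  show "{\<one>, t, l, t \<otimes> l} \<subseteq> generate G {t, l}"
    by (auto intro: generate.one generate.incl generate.eng)
qed

lemma card_edges: "card (rcosets (generate G {t, l})) = 6"
proof -
  have sub: "subgroup (generate G {t, l}) G" by (rule generate_is_subgroup) (use t l in auto)
  have "l \<noteq> t" using l_notin_stabilizer generate.incl[of t "{t, r}" G] by auto
  then have "t \<otimes> l \<noteq> \<one>" using t l involution_inv by (metis inv_equality)
  moreover have "t \<otimes> l \<noteq> t" "t \<otimes> l \<noteq> l" using t l nontrivial by simp_all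
  ultimately have "card (generate G {t, l}) = 4"
    unfolding edge_stabilizer using nontrivial \<open>l \<noteq> t\<close> by (simp add: eq_commute)
  then show ?thesis using lagrange_finite[OF fin sub] order_and_transitivity(1) by simp
qed

text \<open>Since t fixes the base vertex, the four elements y, t y, l y, t l y of an edge lie in
  only two vertices, those of y and of l y. These differ because l is outside the stabilizer, so one
  of the three vertices is missed.\<close>

lemma card_missed_vertices:
  assumes y: "y \<in> carrier G"
  shows "card {v \<in> rcosets (generate G {t, r}). \<not> v \<inter> (generate G {t, l} #> y) \<noteq> {}} = 1"
proof -
  let ?H = "generate G {t, r}" and ?L = "generate G {t, l}"
  have sub: "subgroup ?H G" by (rule generate_is_subgroup) (use t r in auto)
  note Hsub = subgroup.subset[OF sub]
  have tH: "t \<in> ?H" by (rule generate.incl) simp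
  have tc: "?H #> (t \<otimes> x) = ?H #> x" if "x \<in> carrier G" for x
    using that t Hsub coset_join2[OF t(1) sub tH] by (simp flip: coset_mult_assoc)
  have Ly: "?L #> y = {y, t \<otimes> y, l \<otimes> y, t \<otimes> l \<otimes> y}"
    unfolding edge_stabilizer r_coset_def using y by auto
  have meet: "(?H #> x) \<inter> (?L #> y) \<noteq> {} \<longleftrightarrow> ?H #> x \<in> {?H #> y, ?H #> (l \<otimes> y)}"
    if x: "x \<in> carrier G" for x
  proof -
    have mem: "u \<in> ?H #> x \<longleftrightarrow> ?H #> x = ?H #> u" if "u \<in> carrier G" for u
      using that x repr_independence[OF _ x sub] rcos_self[OF that sub] by metis
    have "(?H #> x) \<inter> (?L #> y) \<noteq> {} \<longleftrightarrow>
        y \<in> ?H #> x \<or> t \<otimes> y \<in> ?H #> x \<or> l \<otimes> y \<in> ?H #> x \<or> t \<otimes> l \<otimes> y \<in> ?H #> x"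
      unfolding Ly by blast
    also have "\<dots> \<longleftrightarrow> ?H #> x \<in> {?H #> y, ?H #> (l \<otimes> y)}"
      using mem y t l tc[of y] tc[of "l \<otimes> y"] by (simp add: m_assoc)
    finally show ?thesis .
  qed
  have ne: "?H #> y \<noteq> ?H #> (l \<otimes> y)"
  proof
    assume "?H #> y = ?H #> (l \<otimes> y)"
    then have "?H #> y #> inv y = ?H #> (l \<otimes> y) #> inv y" by simp
    then have "?H = ?H #> l" using y l Hsub by (simp add: coset_mult_assoc m_assoc)
    then show False using coset_join1[OF _ l(1) sub] l_notin_stabilizer by simp
  qed
  have "{v \<in> rcosets ?H. \<not> v \<inter> (?L #> y) \<noteq> {}} = rcosets ?H - {?H #> y, ?H #> (l \<otimes> y)}"
    using meet by (auto simp: RCOSETS_def)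
  moreover have "{?H #> y, ?H #> (l \<otimes> y)} \<subseteq> rcosets ?H" using y l by (auto simp: RCOSETS_def)
  ultimately show ?thesis
    using ne card_vertices by (simp add: card_Diff_subset)
qed

text \<open>Double counting of the pairs of a vertex and an edge missing it: each of the 6 edges
  misses one vertex, and by transitivity the 3 vertices are missed equally often, hence twice
  each.\<close>

lemma is_C32_reduced: "is_C32 (RegMap G t r l)"
proof -
  let ?V = "rcosets (generate G {t, r})" and ?D = "rcosets (generate G {t, l})"
  have subH: "subgroup (generate G {t, r}) G" by (rule generate_is_subgroup) (use t r in auto)
  have subL: "subgroup (generate G {t, l}) G" by (rule generate_is_subgroup) (use t l in auto)
  have V: "card ?V = 3" and D: "card ?D = 6" by (rule card_vertices card_edges)+
  have fin': "finite ?V" "finite ?D" using V D by (auto intro: card_ge_0_finite)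
  have miss: "card {v \<in> ?V. \<not> v \<inter> d \<noteq> {}} = 1" if "d \<in> ?D" for d
    using that card_missed_vertices by (auto simp: RCOSETS_def)
  have missed: "card {d \<in> ?D. \<not> v \<inter> d \<noteq> {}} = 2" if v: "v \<in> ?V" for v
  proof -
    have "card {d \<in> ?D. w \<inter> d = {}} = card {d \<in> ?D. v \<inter> d = {}}" if w: "w \<in> ?V" for w
      using card_disjoint_rcosets_le[OF fin subH subL v w] card_disjoint_rcosets_le[OF fin subH subL w v]
      by simp
    then have "(\<Sum>w\<in>?V. card {d \<in> ?D. w \<inter> d = {}}) = 3 * card {d \<in> ?D. v \<inter> d = {}}"
      using V by simp
    moreover have "(\<Sum>w\<in>?V. card {d \<in> ?D. w \<inter> d = {}}) = 1 * card ?D"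
      by (rule sum_multicount[OF fin']) (use miss in simp)
    ultimately show ?thesis using D by simp
  qed
  have "underlies_doubled_3_cycle (RegMap G t r l)"
    unfolding underlies_doubled_3_cycle_def vertices.simps edges.simps
    by (rule doubled_3_cycleI[OF V D miss missed])
  moreover have "is_map (RegMap G t r l)"
    using t r l tl gen fin nontrivial is_group by (simp add: involution_def)
  ultimately show ?thesis using orientable_iff t_even by (simp add: is_C32_def del: orientable.simps)
qed

end

end


section \<open>Passing to the quotient map\<close>

text \<open>A quotient of \<pi>'-order would make the kernel a normal Hall subgroup. The index of
  the image of \<open>H\<close> divides that of \<open>H\<close>; the quotient c of the two is the
  index of \<open>?N \<inter> H\<close> in \<open>?N\<close>.\<close>

lemma (in finite_group) pi_reduced_Mod:
  assumes solv: "solvable G" and H: "subgroup H G" "pi_number \<pi> (card (rcosets H))"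
    and nh: "\<not> has_normal_hall \<pi> G"
  shows "pi_reduced (G Mod O_pi \<pi> G) \<pi> ((\<lambda>a. O_pi \<pi> G #> a) ` H)"
proof -
  let ?N = "O_pi \<pi> G" and ?Q = "G Mod O_pi \<pi> G" and ?q = "\<lambda>a. O_pi \<pi> G #> a"
  interpret N: normal ?N G by (rule O_pi_normal)
  interpret q: group_hom G ?Q ?q by (rule N.group_hom_Mod)
  interpret Q: finite_group ?Q
    using fin q.H.is_group by (simp add: finite_group_def finite_group_axioms_def carrier_FactGroup)
  have surj: "?q ` carrier G = carrier ?Q" by (simp add: carrier_FactGroup)
  have orderQ: "order ?Q = card (rcosets ?N)" by (simp add: order_def FactGroup_def)
  have subN: "subgroup ?N G" by (rule N.subgroup_axioms)
  have subNH: "subgroup (?N \<inter> H) G" using subgroups_Inter_pair[OF subN H(1)] .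
  have subqH: "subgroup (?q ` H) ?Q" using q.subgroup_img_is_subgroup[OF H(1)] .
  note pos = card_subgroup_pos[OF fin]
  show ?thesis
  proof (rule pi_reduced.intro[OF Q.finite_group_axioms pi_reduced_axioms.intro])
    show "solvable ?Q" using q.surj_hom_imp_solvable[OF surj solv] .
    show "L = {\<one>\<^bsub>?Q\<^esub>}" if "L \<lhd> ?Q" "pi_number \<pi> (card L)" for L
      using O_pi_Mod_O_pi[OF that] .
    show "\<not> pi_number (- \<pi>) (order ?Q)"
    proof
      assume "pi_number (- \<pi>) (order ?Q)"
      then have "hall_subgroup \<pi> ?N G"
        using subN O_pi_pi_number by (simp add: hall_subgroup_def orderQ pi_number_Compl_iff)
      then show False using nh O_pi_normal by (auto simp: has_normal_hall_def)
    qed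
    show "subgroup (?q ` H) ?Q" by (rule subqH)
    obtain c where c: "card ?N = card (?N \<inter> H) * c"
      using card_subgroup_dvd_subgroup[OF fin subNH subN] by auto
    have "card H = card (?q ` H) * card (?N \<inter> H)"
      using q.card_subgroup_image[OF H(1)] by (simp add: N.kernel_Mod)
    then have "card (rcosets H) * card (?q ` H) * card (?N \<inter> H) = order ?Q * card ?N"
      using lagrange_finite[OF fin H(1)] lagrange_finite[OF fin subN] by (simp add: orderQ mult.assoc)
    also have "\<dots> = card (rcosets\<^bsub>?Q\<^esub> (?q ` H)) * card (?q ` H) * (card (?N \<inter> H) * c)"
      using q.H.lagrange_finite[OF Q.fin subqH] c by simp
    finally have "card (rcosets H) = card (rcosets\<^bsub>?Q\<^esub> (?q ` H)) * c"
      using pos[OF subNH] q.H.card_subgroup_pos[OF Q.fin subqH] by (simp add: mult_ac)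
    moreover have "card (rcosets H) > 0"
      using lagrange_finite[OF fin H(1)] fin order_gt_0_iff_finite by (metis nat_0_less_mult_iff)
    ultimately show "pi_number \<pi> (card (rcosets\<^bsub>?Q\<^esub> (?q ` H)))"
      using H(2) pi_number_dvd by (metis dvd_triv_left)
  qed
qed

section \<open>Orientation under quotients\<close>

context generated_by_involutions
begin

text \<open>Squares are even, and an element of odd order is a power of its square.\<close>

lemma odd_normal_subset_even:
  assumes N: "subgroup N G" "odd (card N)"
  shows "N \<subseteq> even_part"
proof
  fix n assume n: "n \<in> N"
  have nc: "n \<in> carrier G" using subgroup.mem_carrier[OF N(1) n] .
  show "n \<in> even_part"
  proof (rule ccontr)
    assume "n \<notin> even_part"
    then have nn: "n \<otimes> n \<in> even_part" using mult_odd_even[OF nc nc] by simp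
    have "odd (ord n)" using ord_subgroup_dvd[OF fin N(1) n] N(2) by (meson dvd_trans)
    then obtain i where "n = (n \<otimes> n) [^] (i::nat)" using odd_ord_pow_square[OF nc] by blast
    moreover have "(n \<otimes> n) [^] int i \<in> even_part" using subgroup_int_pow_closed[OF subgroup_even nn] .
    ultimately show False using \<open>n \<notin> even_part\<close> by (simp add: int_pow_int)
  qed
qed

end

locale map_quotient_by = generated_by_involutions +
  fixes N
  assumes N: "N \<lhd> G"
begin

abbreviation "Q \<equiv> G Mod N"

abbreviation "q \<equiv> (\<lambda>a. N #> a)"

sublocale N: normal N G by (rule N)

sublocale q: group_hom G Q q by (rule N.group_hom_Mod)

sublocale Q: generated_by_involutions Q "q t" "q r" "q l"
proof unfold_locales
  show "finite (carrier Q)" using fin by (simp add: carrier_FactGroup)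
  show "q t \<in> carrier Q" "q r \<in> carrier Q" "q l \<in> carrier Q" using t r l q.hom_closed by auto
  show "q t \<otimes>\<^bsub>Q\<^esub> q t = \<one>\<^bsub>Q\<^esub>" "q r \<otimes>\<^bsub>Q\<^esub> q r = \<one>\<^bsub>Q\<^esub>" "q l \<otimes>\<^bsub>Q\<^esub> q l = \<one>\<^bsub>Q\<^esub>"
    using q.hom_mult[OF t(1) t(1)] q.hom_mult[OF r(1) r(1)] q.hom_mult[OF l(1) l(1)]
      t(2) r(2) l(2) q.hom_one by simp_all
  show "q t \<otimes>\<^bsub>Q\<^esub> q l = q l \<otimes>\<^bsub>Q\<^esub> q t"
    using q.hom_mult[OF t(1) l(1)] q.hom_mult[OF l(1) t(1)] tl by simp
  show "generate Q {q t, q r, q l} = carrier Q"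
    using q.generate_img[of "{t, r, l}"] t r l gen by (simp add: carrier_FactGroup)
qed

lemma image_even: "q ` even_part = Q.even_part"
proof -
  have "q ` {t \<otimes> r, r \<otimes> l} = {q t \<otimes>\<^bsub>Q\<^esub> q r, q r \<otimes>\<^bsub>Q\<^esub> q l}"
    using q.hom_mult t r l by simp
  then show ?thesis using q.generate_img[of "{t \<otimes> r, r \<otimes> l}"] t r l by simp
qed

lemma image_stabilizer: "q ` generate G {t, r} = generate Q {q t, q r}"
  using q.generate_img[of "{t, r}"] t r by simp

text \<open>An odd n in the kernel would make n t an even element with the same image as t.\<close>

lemma kernel_subset_even:
  assumes "q t \<notin> Q.even_part"
  shows "t \<notin> even_part" and "N \<subseteq> even_part"
proof -
  show "t \<notin> even_part" using assms image_even by blast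
  show "N \<subseteq> even_part"
  proof
    fix n assume n: "n \<in> N"
    show "n \<in> even_part"
    proof (rule ccontr)
      assume "n \<notin> even_part"
      then have "n \<otimes> t \<in> even_part" using even_cosets[of n] n by auto
      then have "q (n \<otimes> t) \<in> Q.even_part" using image_even by blast
      moreover have "q (n \<otimes> t) = q t"
        using n t N.subset N.rcos_const[OF is_group n] by (simp flip: coset_mult_assoc)
      ultimately show False using assms by simp
    qed
  qed
qed

text \<open>The generator t differs from an even element by an element of the kernel, which is even
  since the kernel has odd order.\<close>

lemma t_even_of_quotient:
  assumes "q t \<in> Q.even_part" "odd (card N)"
  shows "t \<in> even_part"
proof -
  obtain e where e: "e \<in> even_part" "q t = q e" using assms(1) image_even by blast
  have "t \<in> q e" using rcos_self[OF t(1) N.subgroup_axioms] e(2) by simp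
  then obtain n where n: "n \<in> N" "t = n \<otimes> e" by (auto simp: r_coset_def)
  have "n \<in> even_part" using odd_normal_subset_even[OF N.subgroup_axioms assms(2)] n(1) by blast
  from subgroup.m_closed[OF subgroup_even this e(1)] show ?thesis unfolding n(2)[symmetric] .
qed

text \<open>The index of \<open>N\<close> in the even part is the order of the even part of the
  quotient.\<close>

lemma normal_hall_even:
  assumes "pi_number \<pi> (card N)" "N \<subseteq> even_part" "pi_number (- \<pi>) (card Q.even_part)"
  shows "has_normal_hall \<pi> (G\<lparr>carrier := even_part\<rparr>)"
proof -
  let ?E = "G\<lparr>carrier := even_part\<rparr>"
  interpret E: group ?E using subgroup_imp_group[OF subgroup_even] .
  have norm: "N \<lhd> ?E" by (rule normal_restrict_supergroup[OF subgroup_even N assms(2)])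
  have "card even_part = card Q.even_part * card N"
    using q.card_subgroup_image[OF subgroup_even] image_even assms(2)
    by (simp add: N.kernel_Mod Int_absorb2)
  then have "card (rcosets\<^bsub>?E\<^esub> N) = card Q.even_part"
    using E.lagrange[OF normal_imp_subgroup[OF norm]] card_subgroup_pos[OF fin N.subgroup_axioms]
    by (simp add: order_def)
  then have "hall_subgroup \<pi> N ?E"
    using assms normal_imp_subgroup[OF norm] by (simp add: hall_subgroup_def pi_number_Compl_iff)
  then show ?thesis using norm by (auto simp: has_normal_hall_def)
qed

end

theorem theorem1p7:
  fixes M :: "'a algebraic_map" and Mbar :: "'a set algebraic_map" and \<pi> :: "nat set"
  assumes "is_map M"
    and "\<pi> = vertex_primes M"
    and "solvable (aut_group M)"
    and "\<not> has_normal_hall \<pi> (aut_group M)"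
    and "Mbar = map_quotient M (O_pi \<pi> (aut_group M))"
  shows
    "(2 \<in> \<pi> \<and> orientable M \<and>
       (\<exists>m e. 3 \<le> m \<and> odd m \<and> [e ^ 2 = 1] (mod int m) \<and> \<not> [e = 1] (mod int m) \<and>
              is_D (rotary_map Mbar) m e)) \<or>
     (2 \<in> \<pi> \<and> (\<exists>m \<ge> 1. map_iso Mbar (DM m)) \<and>
       \<not> orientable M \<and> nonnormal_regular M) \<or>
     (2 \<in> \<pi> \<and> (\<exists>m \<ge> 1. map_iso Mbar (EM m)) \<and>
       normal_as_orientably_regular M \<and> nonnormal_regular M) \<or>
     (2 \<notin> \<pi> \<and> 3 \<in> \<pi> \<and> is_C32 Mbar \<and>
       \<not> orientable M \<and> nonnormal_regular M)"
proof (cases M)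
  case (ORMap G r l)
  have "group G" "finite (carrier G)" and r: "r \<in> carrier G"
    and l: "l \<in> carrier G" "l \<otimes>\<^bsub>G\<^esub> l = \<one>\<^bsub>G\<^esub>" and gen: "generate G {r, l} = carrier G"
    using assms(1) ORMap by (auto simp: involution_def)
  then interpret finite_group G by (simp add: finite_group_def finite_group_axioms_def)
  let ?N = "O_pi \<pi> G"
  let ?q = "\<lambda>a. ?N #>\<^bsub>G\<^esub> a"
  interpret N: normal ?N G by (rule O_pi_normal)
  interpret q: group_hom G "G Mod ?N" ?q by (rule N.group_hom_Mod)
  have "pi_number \<pi> (card (rcosets\<^bsub>G\<^esub> (generate G {r})))"
    using assms(2) ORMap by (simp add: vertex_primes_def pi_number_def)
  then interpret Q: pi_reduced "G Mod ?N" \<pi> "?q ` generate G {r}"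
    using pi_reduced_Mod[OF _ generate_is_subgroup[of "{r}"]] assms(3,4) ORMap r by simp
  have "?q l \<otimes>\<^bsub>G Mod ?N\<^esub> ?q l = \<one>\<^bsub>G Mod ?N\<^esub>" using q.hom_mult[of l l] l q.hom_one by metis
  moreover have "?q ` generate G {r} = generate (G Mod ?N) {?q r}"
    using q.generate_img[of "{r}"] r by simp
  moreover have "generate (G Mod ?N) {?q r, ?q l} = carrier (G Mod ?N)"
    using q.generate_img[of "{r, l}"] r l gen by (simp add: carrier_FactGroup)
  ultimately have "2 \<in> \<pi>"
    "\<exists>m e. 3 \<le> m \<and> odd m \<and> [e ^ 2 = 1] (mod int m) \<and> \<not> [e = 1] (mod int m) \<and>
       is_D (ORMap (G Mod ?N) (?q r) (?q l)) m e"
    using Q.cyclic_stabilizer[of "?q r" "?q l"] q.hom_closed r l by blast+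
  then show ?thesis using assms(5) ORMap by simp
next
  case (RegMap G t r l)
  have "group G" "finite (carrier G)" and inv: "involution G t" "involution G r" "involution G l"
    and tl: "t \<otimes>\<^bsub>G\<^esub> l = l \<otimes>\<^bsub>G\<^esub> t" and gen: "generate G {t, r, l} = carrier G"
    using assms(1) RegMap by auto
  then interpret finite_group G by (simp add: finite_group_def finite_group_axioms_def)
  let ?N = "O_pi \<pi> G"
  have "generated_by_involutions G t r l"
    by unfold_locales (use inv tl gen in \<open>auto simp: involution_def\<close>)
  then interpret map_quotient_by G t r l ?N
    using O_pi_normal by (simp add: map_quotient_by_def map_quotient_by_axioms_def)
  have sub: "subgroup (generate G {t, r}) G" by (rule generate_is_subgroup) (use t r in auto)
  have "pi_number \<pi> (card (rcosets\<^bsub>G\<^esub> (generate G {t, r})))"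
    using assms(2) RegMap by (simp add: vertex_primes_def pi_number_def)
  then have "pi_reduced Q \<pi> (q ` generate G {t, r})"
    using pi_reduced_Mod[OF _ sub] assms(3,4) RegMap by simp
  then have "pi_reduced Q \<pi> (generate Q {q t, q r})" unfolding image_stabilizer .
  then interpret R: pi_reduced_regular Q \<pi> "generate Q {q t, q r}" "q t" "q r" "q l"
    using Q.generated_by_involutions_axioms
    by (simp add: pi_reduced_regular_def pi_reduced_regular_axioms_def)
  have Mbar: "Mbar = RegMap Q (q t) (q r) (q l)" using assms(5) RegMap by simp
  have nonnormal: "nonnormal_regular M"
    using assms(2,4) RegMap by (simp add: nonnormal_regular_def normal_as_regular_def)
  have orient: "orientable M \<longleftrightarrow> t \<notin> even_part" unfolding RegMap by (rule orientable_iff)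
  show ?thesis
  proof (cases "2 \<in> \<pi>")
    case two: True
    show ?thesis
    proof (cases "q l = q t")
      case True
      \<comment> \<open>The even part of the quotient is the core here: it avoids the image of t,
        and it has \<pi>'-order, which makes the kernel a Hall subgroup of the even part.\<close>
      have lift: "t \<notin> even_part" "?N \<subseteq> even_part"
        using kernel_subset_even R.is_EM(2)[OF two True] R.t_notin_core[OF two] by simp_all
      have "has_normal_hall \<pi> (G\<lparr>carrier := even_part\<rparr>)"
        using normal_hall_even[OF O_pi_pi_number lift(2)] R.core_pi R.is_EM(2)[OF two True] by simp
      then have "normal_as_orientably_regular M"
        using lift(1) orient assms(2) RegMap by (simp add: normal_as_orientably_regular_def)
      then show ?thesis using two nonnormal R.is_EM(1)[OF two True] Mbar by blast
    next
      case False
      show ?thesis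
      proof (cases "orientable M")
        \<comment> \<open>This includes a trivial image of l. Then l itself is an
          orientation-reversing element of the kernel and the quotient is not orientable, yet
          \<open>rotary_map\<close> of it is still a dipole map.\<close>
        case True
        then show ?thesis using R.is_D_rotary[OF two False] Mbar two by blast
      next
        case nor: False
        then have "q l = \<one>\<^bsub>Q\<^esub>" using R.t_notin_even[OF two] kernel_subset_even(1) orient by blast
        then show ?thesis using R.is_DM[OF two] Mbar two nor nonnormal by blast
      qed
    qed
  next
    case two: False
    \<comment> \<open>Parity is read off from the complement of \<pi>, which contains 2. Odd order
      keeps involutions nontrivial in the quotient and lets nonorientability lift to M.\<close>
    have odd: "odd (card ?N)"
      using two odd_of_pi_number_Compl[of "- \<pi>" "card ?N"] O_pi_pi_number[of \<pi>]
        card_subgroup_pos[OF fin N.subgroup_axioms] by simp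
    have nontriv: "q u \<noteq> \<one>\<^bsub>Q\<^esub>" if u: "involution G u" for u
    proof
      assume "q u = \<one>\<^bsub>Q\<^esub>"
      then have uN: "u \<in> ?N" using u N.rcoset_eq_iff[of u] by (simp add: involution_def)
      then show False
        using involution_eq_one[OF fin N.subgroup_axioms odd uN] u by (simp add: involution_def)
    qed
    note nt = two nontriv[OF inv(1)] nontriv[OF inv(2)] nontriv[OF inv(3)]
    have "\<not> orientable M"
      using t_even_of_quotient[OF R.t_even[OF nt] odd] orient by simp
    then show ?thesis
      using two R.order_and_transitivity(2)[OF nt] R.is_C32_reduced[OF nt] Mbar nonnormal by blast
  qed
qed

end
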